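(* Let $n>2$. In $\mathcal U_{r,s}(\widehat{\mathfrak{sl}_n})$, with $\mathcal U'_{r,s}(\widehat{\mathfrak{sl}_n})$ the subalgebra generated by $E_i,F_i,\omega_i^{\pm1},\omega_i'^{\pm1}$ ($i\in I_0$), $\gamma^{\pm1/2},\gamma'^{\pm1/2},D^{\pm1},D'^{\pm1}$: (1) $x_1^-(1)=[E_2,E_3,\cdots,E_{n-1},E_0]_{(r,\cdots,r)}\,\gamma'\omega_1\in\mathcal U'_{r,s}(\widehat{\mathfrak{sl}_n})$, and $x_i^-(1)\in\mathcal U'_{r,s}(\widehat{\mathfrak{sl}_n})$ for every $i\in I$. (2) $x_1^+(-1)=\tau\big([E_2,E_3,\cdots,E_{n-1},E_0]_{(r,\cdots,r)}\,\gamma'\omega_1\big)=\gamma\omega_1'\,[F_0,F_{n-1},\cdots,F_3,F_2]_{\langle s,\cdots,s\rangle}\in\mathcal U'_{r,s}(\widehat{\mathfrak{sl}_n})$, and $x_i^+(-1)\in\mathcal U'_{r,s}(\widehat{\mathfrak{sl}_n})$ for every $i\in I$.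
   Context: Base field: $\mathbb K=\mathbb Q(r,s)$, rational functions in two indeterminates (so $r\ne\pm s$), with square roots $r^{1/2},s^{1/2}$ adjoined; half-integral powers of monomials in $r,s$ are formed from these. $I=\{1,\dots,n-1\}$, $I_0=\{0\}\cup I$; $\varepsilon_1,\dots,\varepsilon_n$ orthonormal, $\alpha_i=\varepsilon_i-\varepsilon_{i+1}$, $a_{ij}=(\alpha_i,\alpha_j)$. For $i,j\in I$, $\langle i,j\rangle=r^{(\varepsilon_j,\alpha_i)}s^{(\varepsilon_{j+1},\alpha_i)}$, i.e. $\langle i,i\rangle=rs^{-1}$, $\langle i,i+1\rangle=r^{-1}$, $\langle i+1,i\rangle=s$, $\langle i,j\rangle=1$ if $|i-j|>1$. Quantum brackets: $[a,b]_q=ab-q\,ba$, $[a,b]=[a,b]_1$; right-nested: $[a_1,a_2,\cdots,a_m]_{(q_1,\cdots,q_{m-1})}=[a_1,[a_2,\cdots,a_m]_{(q_1,\cdots,q_{m-2})}]_{q_{m-1}}$; left-nested: $[a_1,a_2,\cdots,a_m]_{\langle q,\cdots,q\rangle}=[[\cdots[a_1,a_2]_q,\cdots]_q,a_m]_q$. **$\mathcal U_{r,s}(\widehat{\mathfrak{sl}_n})$** is the unital associative $\mathbb K$-algebra generated by $x_i^\pm(k)$, $a_i(\ell)$, $\omega_i^{\pm1},\omega_i'^{\pm1}$, $\gamma^{\pm1/2},\gamma'^{\pm1/2}$, $D^{\pm1},D'^{\pm1}$ ($i\in I$, $k\in\mathbb Z$, $\ell\in\mathbb Z\setminus\{0\}$)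 with relations: (D1) $\gamma^{\pm1/2},\gamma'^{\pm1/2}$ are central, $\gamma\gamma'=rs$ (with $\gamma^{1/2}\gamma'^{1/2}=(rs)^{1/2}$); $\omega_i^{\pm1},\omega_i'^{\pm1},D^{\pm1},D'^{\pm1}$ commute with one another, exponents $\pm1$ denoting inverses. (D2) $[a_i(\ell),a_j(\ell')]=\delta_{\ell+\ell',0}\frac{(rs)^{|\ell|/2}(\langle i,i\rangle^{\ell a_{ij}/2}-\langle i,i\rangle^{-\ell a_{ij}/2})}{|\ell|(r-s)}\cdot\frac{\gamma^{|\ell|}-\gamma'^{|\ell|}}{r-s}$. (D3) $[a_i(\ell),\omega_j^{\pm1}]=[a_i(\ell),\omega_j'^{\pm1}]=0$. (D4) $Dx_i^\pm(k)D^{-1}=r^kx_i^\pm(k)$, $D'x_i^\pm(k)D'^{-1}=s^kx_i^\pm(k)$, $Da_i(\ell)D^{-1}=r^\ell a_i(\ell)$, $D'a_i(\ell)D'^{-1}=s^\ell a_i(\ell)$. (D5) $\omega_ix_j^\pm(k)\omega_i^{-1}=\langle j,i\rangle^{\pm1}x_j^\pm(k)$, $\omega_i'x_j^\pm(k)\omega_i'^{-1}=\langle i,j\rangle^{\mp1}x_j^\pm(k)$. (D6) $[a_i(\ell),x_j^\pm(k)]=\pm\frac{(rs)^{|\ell|/2}(\langle i,i\rangle^{\ell a_{ij}/2}-\langle i,i\rangle^{-\ell a_{ij}/2})}{\ell(r-s)}\,c\;x_j^\pm(\ell+k)$ with $c=\gamma^{\pm\ell/2}$ if $\ell<0$ and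 $c=\gamma'^{\pm\ell/2}$ if $\ell>0$. (D7) $x_i^\pm(k+1)x_j^\pm(k')-\langle j,i\rangle^{\pm1}x_j^\pm(k')x_i^\pm(k+1)=-(\langle j,i\rangle\langle i,j\rangle^{-1})^{\pm1/2}\big(x_j^\pm(k'+1)x_i^\pm(k)-\langle i,j\rangle^{\pm1}x_i^\pm(k)x_j^\pm(k'+1)\big)$. (D8) $[x_i^+(k),x_j^-(k')]=\frac{\delta_{ij}}{r-s}\big(\gamma'^{-k}\gamma^{-(k+k')/2}\omega_i(k+k')-\gamma^{k'}\gamma'^{(k+k')/2}\omega_i'(k+k')\big)$, where $\sum_{m\ge0}\omega_i(m)z^{-m}=\omega_i\exp\big((r-s)\sum_{\ell\ge1}a_i(\ell)z^{-\ell}\big)$, $\sum_{m\ge0}\omega_i'(-m)z^m=\omega_i'\exp\big(-(r-s)\sum_{\ell\ge1}a_i(-\ell)z^\ell\big)$, and $\omega_i(-m)=0=\omega_i'(m)$ for $m>0$. (D9) $x_i^\pm(m)x_j^\pm(k)=x_j^\pm(k)x_i^\pm(m)$ if $a_{ij}=0$; and if $a_{ij}=-1$, $\mathrm{Sym}_{m_1,m_2}\big(x_i^\pm(m_1)x_i^\pm(m_2)x_j^\pm(k)-(p+q)x_i^\pm(m_1)x_j^\pm(k)x_i^\pm(m_2)+pq\,x_j^\pm(k)x_i^\pm(m_1)x_i^\pm(m_2)\big)=0$, where $(p,q)=(r^{\pm1},s^{\pm1})$ if $i<j$ and $(p,q)=(r^{\mp1},s^{\mp1})$ if $j<i$; $\mathrm{Sym}$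 is symmetrization in $(m_1,m_2)$. $\tau$ is the $\mathbb Q$-algebra antiautomorphism of $\mathcal U_{r,s}(\widehat{\mathfrak{sl}_n})$ interchanging $r\leftrightarrow s$ (and $r^{1/2}\leftrightarrow s^{1/2}$), $\omega_i\leftrightarrow\omega_i'$, $\gamma^{1/2}\leftrightarrow\gamma'^{1/2}$, $D\leftrightarrow D'$, $a_i(\ell)\leftrightarrow a_i(-\ell)$, $x_i^\pm(m)\leftrightarrow x_i^\mp(-m)$. Elements: $\omega_\theta=\omega_1\cdots\omega_{n-1}$, $\omega'_\theta=\omega'_1\cdots\omega'_{n-1}$, $\omega_0=\gamma'^{-1}\omega_\theta^{-1}$, $\omega_0'=\gamma^{-1}\omega_\theta'^{-1}$; $E_i=x_i^+(0)$, $F_i=x_i^-(0)$ for $i\in I$; $E_0=x_\theta^-(1)\gamma'^{-1}\omega_\theta^{-1}$, $F_0=\gamma^{-1}\omega_\theta'^{-1}x_\theta^+(-1)$, where $x_\theta^-(1)=[x_{n-1}^-(0),\cdots,[x_2^-(0),x_1^-(1)]_s\cdots]_s$ and $x_\theta^+(-1)=[\cdots[x_1^+(-1),x_2^+(0)]_r,\cdots,x_{n-1}^+(0)]_r$. *)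

theory Defs
  imports
    "HOL-Library.Poly_Mapping"
    "HOL-Library.Cardinality"
    "HOL-Computational_Algebra.Polynomial"
    "HOL-Computational_Algebra.Fraction_Field"
    "HOL-Computational_Algebra.Formal_Power_Series"
begin

section \<open>The base field\<close>

text \<open>
  \<open>\<rat>(r, s)\<close> with \<open>r\<^sup>1\<^sup>/\<^sup>2\<close> and \<open>s\<^sup>1\<^sup>/\<^sup>2\<close> adjoined is the field of rational functions in the two
  indeterminates \<open>rh = r\<^sup>1\<^sup>/\<^sup>2\<close> and \<open>sh = s\<^sup>1\<^sup>/\<^sup>2\<close>.
\<close>

type_synonym K = "rat poly poly fract"

definition rh :: K where "rh = Fract [:[:0, 1:]:] 1"
definition sh :: K where "sh = Fract [:0, 1:] 1"

definition r :: K where "r = rh ^ 2"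
definition s :: K where "s = sh ^ 2"

text \<open>\<open>eps_alpha j i\<close> is \<open>(\<epsilon>\<^sub>j, \<alpha>\<^sub>i)\<close> and \<open>cartan i j\<close> is \<open>a\<^sub>i\<^sub>j = (\<alpha>\<^sub>i, \<alpha>\<^sub>j)\<close>.\<close>

definition eps_alpha :: "nat \<Rightarrow> nat \<Rightarrow> int" where
  "eps_alpha j i = (if j = i then 1 else 0) - (if j = i + 1 then 1 else 0)"

definition cartan :: "nat \<Rightarrow> nat \<Rightarrow> int" where
  "cartan i j = eps_alpha i j - eps_alpha (i + 1) j"

text \<open>
  \<open>br i j\<close> is \<open>\<langle>i,j\<rangle>\<close>. Its half-integral powers are formed from the monomial square root \<open>brh i j\<close>:
  \<open>\<langle>i,j\<rangle>\<^sup>m\<^sup>/\<^sup>2\<close> is \<open>brh i j powi m\<close>.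
\<close>

definition br :: "nat \<Rightarrow> nat \<Rightarrow> K" where
  "br i j = r powi eps_alpha j i * s powi eps_alpha (j + 1) i"

definition brh :: "nat \<Rightarrow> nat \<Rightarrow> K" where
  "brh i j = rh powi eps_alpha j i * sh powi eps_alpha (j + 1) i"

lemma brh_square: "brh i j ^ 2 = br i j"
  by (simp add: br_def brh_def r_def s_def power_mult_distrib power_int_def power_mult [symmetric]
      mult.commute power_inverse)

lemma br_values:
  "br i i = r * inverse s" "br i (i + 1) = inverse r" "br (i + 1) i = s"
  "i + 1 < j \<Longrightarrow> br i j = 1" "j + 1 < i \<Longrightarrow> br i j = 1"
  by (auto simp: br_def eps_alpha_def power_int_minus)

section \<open>The free algebra on the Drinfeld generators\<close>

datatype sgn = Plus | Minus

primrec sg :: "sgn \<Rightarrow> int" where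
  "sg Plus = 1" | "sg Minus = - 1"

primrec opp :: "sgn \<Rightarrow> sgn" where
  "opp Plus = Minus" | "opp Minus = Plus"

text \<open>
  \<open>XG e i k\<close> is \<open>x\<^sub>i\<^sup>\<plusminus>(k)\<close> and \<open>AG i l\<close> is \<open>a\<^sub>i(l)\<close>. In the remaining generators the sign is that of
  the exponent: \<open>\<omega>\<^sub>i\<^sup>\<plusminus>\<^sup>1\<close>, \<open>\<omega>'\<^sub>i\<^sup>\<plusminus>\<^sup>1\<close>, \<open>\<gamma>\<^sup>\<plusminus>\<^sup>1\<^sup>/\<^sup>2\<close>, \<open>\<gamma>'\<^sup>\<plusminus>\<^sup>1\<^sup>/\<^sup>2\<close>, \<open>D\<^sup>\<plusminus>\<^sup>1\<close>, \<open>D'\<^sup>\<plusminus>\<^sup>1\<close>.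
\<close>

datatype letter =
    XG sgn nat int
  | AG nat int
  | OmG sgn nat
  | OmG' sgn nat
  | GamG sgn
  | GamG' sgn
  | DG sgn
  | DG' sgn

definition nodes :: "nat \<Rightarrow> nat set" where
  "nodes n = {1..<n}"

definition letters :: "nat \<Rightarrow> letter set" where
  "letters n =
     {XG e i k | e i k. i \<in> nodes n} \<union> {AG i l | i l. i \<in> nodes n \<and> l \<noteq> 0} \<union>
     {OmG e i | e i. i \<in> nodes n} \<union> {OmG' e i | e i. i \<in> nodes n} \<union>
     range GamG \<union> range GamG' \<union> range DG \<union> range DG'"

text \<open>
  The parameter \<open>n\<close> is \<open>CARD('n)\<close> (which is \<open>0\<close> for infinite \<open>'n\<close>), so that the algebra becomes
  a type; nothing else about \<open>'n\<close> is used. The free monoid on the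
  generators is written additively, because the product of \<open>_ \<Rightarrow>\<^sub>0 _\<close> is convolution along \<open>+\<close>;
  the free algebra is then the monoid algebra of the free monoid.
\<close>

typedef 'n word = "{w. set w \<subseteq> letters CARD('n)}"
  by (rule exI [of _ "[]"]) simp

setup_lifting type_definition_word

instantiation word :: (type) monoid_add
begin

lift_definition zero_word :: "'a word" is "[]" by simp

lift_definition plus_word :: "'a word \<Rightarrow> 'a word \<Rightarrow> 'a word" is "(@)" by simp

instance by standard (transfer, simp)+

end

type_synonym 'n free = "'n word \<Rightarrow>\<^sub>0 K"

definition scalf :: "K \<Rightarrow> 'n free" where
  "scalf c = Poly_Mapping.single 0 c"

text \<open>Letters outside \<open>letters CARD('n)\<close> are not generators; they are given the dummy value \<open>0\<close>.\<close>

definition genf :: "letter \<Rightarrow> 'n free" where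
  "genf g = (if g \<in> letters CARD('n) then Poly_Mapping.single (Abs_word [g]) 1 else 0)"

section \<open>The defining relations\<close>

text \<open>\<open>gamf m\<close> is \<open>\<gamma>\<^sup>m\<^sup>/\<^sup>2\<close> and \<open>gamf' m\<close> is \<open>\<gamma>'\<^sup>m\<^sup>/\<^sup>2\<close>.\<close>

definition gamf :: "int \<Rightarrow> 'n free" where
  "gamf m = (if 0 \<le> m then genf (GamG Plus) ^ nat m else genf (GamG Minus) ^ nat (- m))"

definition gamf' :: "int \<Rightarrow> 'n free" where
  "gamf' m = (if 0 \<le> m then genf (GamG' Plus) ^ nat m else genf (GamG' Minus) ^ nat (- m))"

text \<open>
  Coefficient of \<open>z\<^sup>m\<close> in \<open>exp f\<close>, for a power series \<open>f\<close> with zero constant term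
  (then \<open>f ^ k\<close> does not contribute for \<open>k > m\<close>).
\<close>

definition exp_coeff :: "'n free fps \<Rightarrow> nat \<Rightarrow> 'n free" where
  "exp_coeff f m = (\<Sum>k\<le>m. scalf (1 / of_nat (fact k)) * fps_nth (f ^ k) m)"

text \<open>\<open>om_mode i m\<close> is \<open>\<omega>\<^sub>i(m)\<close> and \<open>om_mode' i m\<close> is \<open>\<omega>'\<^sub>i(m)\<close>.\<close>

definition om_mode :: "nat \<Rightarrow> int \<Rightarrow> 'n free" where
  "om_mode i m =
     (if m < 0 then 0
      else genf (OmG Plus i) *
        exp_coeff (Abs_fps (\<lambda>l. if l = 0 then 0 else scalf (r - s) * genf (AG i (int l)))) (nat m))"

definition om_mode' :: "nat \<Rightarrow> int \<Rightarrow> 'n free" where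
  "om_mode' i m =
     (if m > 0 then 0
      else genf (OmG' Plus i) *
        exp_coeff (Abs_fps (\<lambda>l. if l = 0 then 0 else scalf (- (r - s)) * genf (AG i (- int l))))
          (nat (- m)))"

text \<open>\<open>(rs)\<^sup>|\<^sup>l\<^sup>|\<^sup>/\<^sup>2 (\<langle>i,i\<rangle>\<^sup>l\<^sup>a\<^sup>/\<^sup>2 - \<langle>i,i\<rangle>\<^sup>-\<^sup>l\<^sup>a\<^sup>/\<^sup>2)\<close> with \<open>a = a\<^sub>i\<^sub>j\<close>.\<close>

definition acoeff :: "nat \<Rightarrow> nat \<Rightarrow> int \<Rightarrow> K" where
  "acoeff i j l =
     (rh * sh) powi \<bar>l\<bar> * (brh i i powi (l * cartan i j) - brh i i powi (- (l * cartan i j)))"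

definition torus :: "nat \<Rightarrow> letter set" where
  "torus n = {OmG e i | e i. i \<in> nodes n} \<union> {OmG' e i | e i. i \<in> nodes n} \<union> range DG \<union> range DG'"

definition serre :: "sgn \<Rightarrow> nat \<Rightarrow> nat \<Rightarrow> K \<Rightarrow> K \<Rightarrow> int \<Rightarrow> int \<Rightarrow> int \<Rightarrow> 'n free" where
  "serre e i j p q m1 m2 k =
     genf (XG e i m1) * genf (XG e i m2) * genf (XG e j k)
     - scalf (p + q) * genf (XG e i m1) * genf (XG e j k) * genf (XG e i m2)
     + scalf (p * q) * genf (XG e j k) * genf (XG e i m1) * genf (XG e i m2)"

text \<open>
  \<open>rel x y\<close> imposes \<open>x = y\<close>. Squaring \<open>gamma_product\<close> yields \<open>\<gamma>\<gamma>' = rs\<close>.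
\<close>

inductive rel :: "'n free \<Rightarrow> 'n free \<Rightarrow> bool" where
  gamma_central: "rel (genf (GamG e) * y) (y * genf (GamG e))"
| gamma'_central: "rel (genf (GamG' e) * y) (y * genf (GamG' e))"
| gamma_inverse: "rel (genf (GamG e) * genf (GamG (opp e))) 1"
| gamma'_inverse: "rel (genf (GamG' e) * genf (GamG' (opp e))) 1"
| gamma_product: "rel (genf (GamG Plus) * genf (GamG' Plus)) (scalf (rh * sh))"
| torus_commute: "g \<in> torus CARD('n) \<Longrightarrow> h \<in> torus CARD('n) \<Longrightarrow>
    rel (genf g * genf h :: 'n free) (genf h * genf g)"
| omega_inverse: "i \<in> nodes CARD('n) \<Longrightarrow> rel (genf (OmG e i) * genf (OmG (opp e) i) :: 'n free) 1"
| omega'_inverse: "i \<in> nodes CARD('n) \<Longrightarrow> rel (genf (OmG' e i) * genf (OmG' (opp e) i) :: 'n free) 1"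
| D_inverse: "rel (genf (DG e) * genf (DG (opp e))) 1"
| D'_inverse: "rel (genf (DG' e) * genf (DG' (opp e))) 1"
| a_a: "i \<in> nodes CARD('n) \<Longrightarrow> j \<in> nodes CARD('n) \<Longrightarrow> l \<noteq> 0 \<Longrightarrow> l' \<noteq> 0 \<Longrightarrow>
    rel (genf (AG i l) * genf (AG j l') - genf (AG j l') * genf (AG i l) :: 'n free)
      (if l + l' = 0
       then scalf (acoeff i j l / (of_int \<bar>l\<bar> * (r - s)) / (r - s)) *
         (gamf (2 * \<bar>l\<bar>) - gamf' (2 * \<bar>l\<bar>))
       else 0)"
| a_omega: "i \<in> nodes CARD('n) \<Longrightarrow> j \<in> nodes CARD('n) \<Longrightarrow> l \<noteq> 0 \<Longrightarrow>
    rel (genf (AG i l) * genf (OmG e j) :: 'n free) (genf (OmG e j) * genf (AG i l))"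
| a_omega': "i \<in> nodes CARD('n) \<Longrightarrow> j \<in> nodes CARD('n) \<Longrightarrow> l \<noteq> 0 \<Longrightarrow>
    rel (genf (AG i l) * genf (OmG' e j) :: 'n free) (genf (OmG' e j) * genf (AG i l))"
| D_x: "i \<in> nodes CARD('n) \<Longrightarrow>
    rel (genf (DG Plus) * genf (XG e i k) * genf (DG Minus) :: 'n free)
      (scalf (r powi k) * genf (XG e i k))"
| D'_x: "i \<in> nodes CARD('n) \<Longrightarrow>
    rel (genf (DG' Plus) * genf (XG e i k) * genf (DG' Minus) :: 'n free)
      (scalf (s powi k) * genf (XG e i k))"
| D_a: "i \<in> nodes CARD('n) \<Longrightarrow> l \<noteq> 0 \<Longrightarrow>
    rel (genf (DG Plus) * genf (AG i l) * genf (DG Minus) :: 'n free)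
      (scalf (r powi l) * genf (AG i l))"
| D'_a: "i \<in> nodes CARD('n) \<Longrightarrow> l \<noteq> 0 \<Longrightarrow>
    rel (genf (DG' Plus) * genf (AG i l) * genf (DG' Minus) :: 'n free)
      (scalf (s powi l) * genf (AG i l))"
| omega_x: "i \<in> nodes CARD('n) \<Longrightarrow> j \<in> nodes CARD('n) \<Longrightarrow>
    rel (genf (OmG Plus i) * genf (XG e j k) * genf (OmG Minus i) :: 'n free)
      (scalf (br j i powi sg e) * genf (XG e j k))"
| omega'_x: "i \<in> nodes CARD('n) \<Longrightarrow> j \<in> nodes CARD('n) \<Longrightarrow>
    rel (genf (OmG' Plus i) * genf (XG e j k) * genf (OmG' Minus i) :: 'n free)
      (scalf (br i j powi (- sg e)) * genf (XG e j k))"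
| a_x: "i \<in> nodes CARD('n) \<Longrightarrow> j \<in> nodes CARD('n) \<Longrightarrow> l \<noteq> 0 \<Longrightarrow>
    rel (genf (AG i l) * genf (XG e j k) - genf (XG e j k) * genf (AG i l) :: 'n free)
      (scalf (of_int (sg e) * acoeff i j l / (of_int l * (r - s))) *
       (if l < 0 then gamf (sg e * l) else gamf' (sg e * l)) * genf (XG e j (l + k)))"
| x_x: "i \<in> nodes CARD('n) \<Longrightarrow> j \<in> nodes CARD('n) \<Longrightarrow>
    rel (genf (XG e i (k + 1)) * genf (XG e j k')
         - scalf (br j i powi sg e) * genf (XG e j k') * genf (XG e i (k + 1)) :: 'n free)
      (- scalf ((brh j i / brh i j) powi sg e) *
       (genf (XG e j (k' + 1)) * genf (XG e i k)
        - scalf (br i j powi sg e) * genf (XG e i k) * genf (XG e j (k' + 1))))"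
| xplus_xminus: "i \<in> nodes CARD('n) \<Longrightarrow> j \<in> nodes CARD('n) \<Longrightarrow>
    rel (genf (XG Plus i k) * genf (XG Minus j k') - genf (XG Minus j k') * genf (XG Plus i k) :: 'n free)
      (if i = j
       then scalf (1 / (r - s)) *
         (gamf' (- 2 * k) * gamf (- (k + k')) * om_mode i (k + k')
          - gamf (2 * k') * gamf' (k + k') * om_mode' i (k + k'))
       else 0)"
| x_commute: "i \<in> nodes CARD('n) \<Longrightarrow> j \<in> nodes CARD('n) \<Longrightarrow> cartan i j = 0 \<Longrightarrow>
    rel (genf (XG e i m) * genf (XG e j k) :: 'n free) (genf (XG e j k) * genf (XG e i m))"
| x_serre: "i \<in> nodes CARD('n) \<Longrightarrow> j \<in> nodes CARD('n) \<Longrightarrow> cartan i j = - 1 \<Longrightarrow>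
    t = (if i < j then sg e else - sg e) \<Longrightarrow>
    rel (serre e i j (r powi t) (s powi t) m1 m2 k + serre e i j (r powi t) (s powi t) m2 m1 k :: 'n free) 0"

section \<open>The quantum affine algebra\<close>

text \<open>
  The quotient of the free algebra by the two-sided ideal generated by the relations. It is made an
  instance of \<open>ring\<close> and \<open>monoid_mult\<close> rather than \<open>ring_1\<close>, since \<open>ring_1\<close> includes \<open>0 \<noteq> 1\<close>.
\<close>

inductive_set rel_ideal :: "'n free set" where
  rel: "rel x y \<Longrightarrow> x - y \<in> rel_ideal"
| zero: "0 \<in> rel_ideal"
| add: "x \<in> rel_ideal \<Longrightarrow> y \<in> rel_ideal \<Longrightarrow> x + y \<in> rel_ideal"
| mult_left: "x \<in> rel_ideal \<Longrightarrow> a * x \<in> rel_ideal"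
| mult_right: "x \<in> rel_ideal \<Longrightarrow> x * a \<in> rel_ideal"

lemma rel_ideal_uminus: "x \<in> rel_ideal \<Longrightarrow> - x \<in> rel_ideal"
  using rel_ideal.mult_left [of x "- 1"] by simp

definition cong_rel :: "'n free \<Rightarrow> 'n free \<Rightarrow> bool" where
  "cong_rel x y \<longleftrightarrow> x - y \<in> rel_ideal"

lemma equivp_cong_rel: "equivp (cong_rel :: 'n free \<Rightarrow> _)"
proof (rule equivpI)
  show "reflp (cong_rel :: 'n free \<Rightarrow> _)"
    by (simp add: reflp_def cong_rel_def rel_ideal.zero)
  show "symp (cong_rel :: 'n free \<Rightarrow> _)"
  proof (rule sympI)
    fix x y :: "'n free"
    assume "cong_rel x y"
    then have "- (x - y) \<in> rel_ideal"
      unfolding cong_rel_def by (rule rel_ideal_uminus)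
    then show "cong_rel y x"
      by (simp add: cong_rel_def)
  qed
  show "transp (cong_rel :: 'n free \<Rightarrow> _)"
  proof (rule transpI)
    fix x y z :: "'n free"
    assume "cong_rel x y" "cong_rel y z"
    then have "(x - y) + (y - z) \<in> rel_ideal"
      unfolding cong_rel_def by (rule rel_ideal.add)
    then show "cong_rel x z"
      by (simp add: cong_rel_def)
  qed
qed

quotient_type 'n qaff = "'n free" / cong_rel
  by (rule equivp_cong_rel)

instantiation qaff :: (type) "{ring, monoid_mult}"
begin

lift_definition zero_qaff :: "'a qaff" is 0 .

lift_definition one_qaff :: "'a qaff" is 1 .

lift_definition plus_qaff :: "'a qaff \<Rightarrow> 'a qaff \<Rightarrow> 'a qaff" is "(+)"
proof -
  fix x x' y y' :: "'a free"
  assume "cong_rel x x'" "cong_rel y y'"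
  then have "(x - x') + (y - y') \<in> rel_ideal"
    unfolding cong_rel_def by (rule rel_ideal.add)
  then show "cong_rel (x + y) (x' + y')"
    by (simp add: cong_rel_def algebra_simps)
qed

lift_definition uminus_qaff :: "'a qaff \<Rightarrow> 'a qaff" is uminus
proof -
  fix x x' :: "'a free"
  assume "cong_rel x x'"
  then have "- (x - x') \<in> rel_ideal"
    unfolding cong_rel_def by (rule rel_ideal_uminus)
  then show "cong_rel (- x) (- x')"
    by (simp add: cong_rel_def)
qed

lift_definition minus_qaff :: "'a qaff \<Rightarrow> 'a qaff \<Rightarrow> 'a qaff" is "(-)"
proof -
  fix x x' y y' :: "'a free"
  assume "cong_rel x x'" "cong_rel y y'"
  then have "(x - x') + - (y - y') \<in> rel_ideal"
    unfolding cong_rel_def by (intro rel_ideal.add rel_ideal_uminus)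
  then show "cong_rel (x - y) (x' - y')"
    by (simp add: cong_rel_def algebra_simps)
qed

lift_definition times_qaff :: "'a qaff \<Rightarrow> 'a qaff \<Rightarrow> 'a qaff" is "(*)"
proof -
  fix x x' y y' :: "'a free"
  assume "cong_rel x x'" "cong_rel y y'"
  then have "(x - x') * y + x' * (y - y') \<in> rel_ideal"
    unfolding cong_rel_def by (intro rel_ideal.add rel_ideal.mult_left rel_ideal.mult_right)
  then show "cong_rel (x * y) (x' * y')"
    by (simp add: cong_rel_def algebra_simps)
qed

instance
proof
  fix a b c :: "'a qaff"
  show "a + b + c = a + (b + c)" "a + b = b + a" "0 + a = a" "- a + a = 0" "a - b = a + - b"
    "a * b * c = a * (b * c)" "(a + b) * c = a * c + b * c" "a * (b + c) = a * b + a * c"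
    "1 * a = a" "a * 1 = a"
    by (transfer, simp add: algebra_simps cong_rel_def rel_ideal.zero)+
qed

end

text \<open>The structure map of the \<open>K\<close>-algebra \<open>'n qaff\<close>, and the images of the generators.\<close>

lift_definition scal :: "K \<Rightarrow> 'n qaff" is scalf .

lift_definition gen :: "letter \<Rightarrow> 'n qaff" is genf .

inductive_set subalgebra_generated :: "'n qaff set \<Rightarrow> 'n qaff set" for S :: "'n qaff set" where
  base: "x \<in> S \<Longrightarrow> x \<in> subalgebra_generated S"
| scal: "scal c \<in> subalgebra_generated S"
| add: "x \<in> subalgebra_generated S \<Longrightarrow> y \<in> subalgebra_generated S \<Longrightarrow> x + y \<in> subalgebra_generated S"
| mult: "x \<in> subalgebra_generated S \<Longrightarrow> y \<in> subalgebra_generated S \<Longrightarrow> x * y \<in> subalgebra_generated S"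

section \<open>Quantum brackets\<close>

definition qbracket :: "K \<Rightarrow> 'n qaff \<Rightarrow> 'n qaff \<Rightarrow> 'n qaff" where
  "qbracket q a b = a * b - scal q * b * a"

text \<open>\<open>[a\<^sub>1, \<dots>, a\<^sub>m]\<close> with subscript \<open>(q\<^sub>1, \<dots>, q\<^sub>m\<^sub>-\<^sub>1)\<close>; the outermost bracket carries the last \<open>q\<close>.\<close>

fun rnested :: "K list \<Rightarrow> 'n qaff list \<Rightarrow> 'n qaff" where
  "rnested qs [] = 0"
| "rnested qs [a] = a"
| "rnested qs (a # b # as) = qbracket (last qs) a (rnested (butlast qs) (b # as))"

text \<open>\<open>[a\<^sub>1, \<dots>, a\<^sub>m]\<close> with subscript \<open>\<langle>q, \<dots>, q\<rangle>\<close>.\<close>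

fun lnested :: "K \<Rightarrow> 'n qaff list \<Rightarrow> 'n qaff" where
  "lnested q [] = 0"
| "lnested q (a # as) = foldl (qbracket q) a as"

section \<open>Chevalley type elements\<close>

abbreviation xp :: "nat \<Rightarrow> int \<Rightarrow> 'n qaff" where "xp i k \<equiv> gen (XG Plus i k)"
abbreviation xm :: "nat \<Rightarrow> int \<Rightarrow> 'n qaff" where "xm i k \<equiv> gen (XG Minus i k)"

text \<open>\<open>\<gamma>\<^sup>\<plusminus>\<^sup>1\<close> and \<open>\<gamma>'\<^sup>\<plusminus>\<^sup>1\<close>\<close>

definition gamma :: "sgn \<Rightarrow> 'n qaff" where "gamma e = gen (GamG e) ^ 2"
definition gamma' :: "sgn \<Rightarrow> 'n qaff" where "gamma' e = gen (GamG' e) ^ 2"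

text \<open>\<open>\<omega>\<^sub>\<theta>\<^sup>\<plusminus>\<^sup>1\<close> and \<open>\<omega>'\<^sub>\<theta>\<^sup>\<plusminus>\<^sup>1\<close>; the order of the factors does not matter, as they commute.\<close>

definition om_theta :: "sgn \<Rightarrow> 'n qaff" where
  "om_theta e = prod_list (map (\<lambda>i. gen (OmG e i)) [1..<CARD('n)])"

definition om_theta' :: "sgn \<Rightarrow> 'n qaff" where
  "om_theta' e = prod_list (map (\<lambda>i. gen (OmG' e i)) [1..<CARD('n)])"

text \<open>\<open>\<omega>\<^sub>i\<^sup>\<plusminus>\<^sup>1\<close> and \<open>\<omega>'\<^sub>i\<^sup>\<plusminus>\<^sup>1\<close> for \<open>i \<in> I\<^sub>0\<close>\<close>

definition om :: "sgn \<Rightarrow> nat \<Rightarrow> 'n qaff" where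
  "om e i = (if i = 0 then gamma' (opp e) * om_theta (opp e) else gen (OmG e i))"

definition om' :: "sgn \<Rightarrow> nat \<Rightarrow> 'n qaff" where
  "om' e i = (if i = 0 then gamma (opp e) * om_theta' (opp e) else gen (OmG' e i))"

text \<open>\<open>x\<^sub>\<theta>\<^sup>-(1)\<close> and \<open>x\<^sub>\<theta>\<^sup>+(-1)\<close>\<close>

definition xm_theta :: "'n qaff" where
  "xm_theta = rnested (replicate (CARD('n) - 2) s)
     (map (\<lambda>i. xm i 0) (rev [2..<CARD('n)]) @ [xm 1 1])"

definition xp_theta :: "'n qaff" where
  "xp_theta = lnested r (xp 1 (- 1) # map (\<lambda>i. xp i 0) [2..<CARD('n)])"

definition E :: "nat \<Rightarrow> 'n qaff" where
  "E i = (if i = 0 then xm_theta * gamma' Minus * om_theta Minus else xp i 0)"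

definition F :: "nat \<Rightarrow> 'n qaff" where
  "F i = (if i = 0 then gamma Minus * om_theta' Minus * xp_theta else xm i 0)"

definition U' :: "'n qaff set" where
  "U' = subalgebra_generated
     ({E i | i. i < CARD('n)} \<union> {F i | i. i < CARD('n)} \<union>
      {om e i | e i. i < CARD('n)} \<union> {om' e i | e i. i < CARD('n)} \<union>
      range (\<lambda>e. gen (GamG e)) \<union> range (\<lambda>e. gen (GamG' e)) \<union>
      range (\<lambda>e. gen (DG e)) \<union> range (\<lambda>e. gen (DG' e)))"

section \<open>The antiautomorphism\<close>

text \<open>Additivity makes \<open>t\<close> linear over \<open>\<rat>\<close>; it is not linear over \<open>K\<close>.\<close>

definition is_tau :: "('n qaff \<Rightarrow> 'n qaff) \<Rightarrow> bool" where
  "is_tau t \<longleftrightarrow>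
     bij t \<and> t 1 = 1 \<and> (\<forall>x y. t (x + y) = t x + t y) \<and> (\<forall>x y. t (x * y) = t y * t x) \<and>
     t (scal rh) = scal sh \<and> t (scal sh) = scal rh \<and>
     (\<forall>i \<in> nodes CARD('n). \<forall>e. t (gen (OmG e i)) = gen (OmG' e i) \<and> t (gen (OmG' e i)) = gen (OmG e i)) \<and>
     (\<forall>e. t (gen (GamG e)) = gen (GamG' e) \<and> t (gen (GamG' e)) = gen (GamG e)) \<and>
     (\<forall>e. t (gen (DG e)) = gen (DG' e) \<and> t (gen (DG' e)) = gen (DG e)) \<and>
     (\<forall>i \<in> nodes CARD('n). \<forall>l. l \<noteq> 0 \<longrightarrow> t (gen (AG i l)) = gen (AG i (- l))) \<and>
     (\<forall>i \<in> nodes CARD('n). \<forall>e m. t (gen (XG e i m)) = gen (XG (opp e) i (- m)))"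

definition tau :: "'n qaff \<Rightarrow> 'n qaff" where
  "tau = (THE t. is_tau t)"

end

theory Submission
  imports Defs
begin

text \<open>
  Write \<open>Y\<^sub>k = [x\<^sub>k\<^sup>-(0), \<dots>, [x\<^sub>2\<^sup>-(0), x\<^sub>1\<^sup>-(1)]\<^sub>s \<dots>]\<^sub>s\<close> and \<open>\<Omega>\<^sub>k = \<omega>\<^sub>1 \<cdots> \<omega>\<^sub>k\<close>, so that
  \<open>E\<^sub>0 = Y\<^sub>n\<^sub>-\<^sub>1 \<gamma>'\<^sup>-\<^sup>1 \<Omega>\<^sub>n\<^sub>-\<^sub>1\<^sup>-\<^sup>1\<close>. As \<open>x\<^sub>k\<^sup>+(0)\<close> commutes with \<open>Y\<^sub>k\<^sub>-\<^sub>1\<close>, while \<open>\<omega>\<^sub>k\<close> and \<open>\<omega>'\<^sub>k\<close> scale it by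
  \<open>r\<close> and \<open>s\<close>, one gets \<open>[x\<^sub>k\<^sup>+(0), Y\<^sub>k] = Y\<^sub>k\<^sub>-\<^sub>1 \<omega>\<^sub>k\<close>; since \<open>\<Omega>\<^sub>k\<close> scales \<open>x\<^sub>k\<^sup>+(0)\<close> by \<open>r\<close>, bracketing with
  \<open>E\<^sub>k\<close> turns \<open>Y\<^sub>k \<gamma>'\<^sup>-\<^sup>1 \<Omega>\<^sub>k\<^sup>-\<^sup>1\<close> into \<open>Y\<^sub>k\<^sub>-\<^sub>1 \<gamma>'\<^sup>-\<^sup>1 \<Omega>\<^sub>k\<^sub>-\<^sub>1\<^sup>-\<^sup>1\<close>, and \<open>k = 1\<close> leaves \<open>x\<^sub>1\<^sup>-(1)\<close>. From \<open>x\<^sub>i\<^sup>-(1)\<close> one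
  recovers \<open>a\<^sub>i(1)\<close> by bracketing with \<open>x\<^sub>i\<^sup>+(0)\<close>, and then \<open>x\<^sub>i\<^sub>+\<^sub>1\<^sup>-(1)\<close> by bracketing with \<open>x\<^sub>i\<^sub>+\<^sub>1\<^sup>-(0)\<close>.
  The second part is the image of the first under \<open>\<tau>\<close>, which maps \<open>U'\<close> to itself. That \<open>\<tau>\<close> exists
  means that the reversal of words, combined with \<open>r \<leftrightarrow> s\<close> and the exchange of generators, respects
  every defining relation; it is unique because it is prescribed on generators of the ring.
\<close>

section \<open>The automorphism of the base field exchanging \<open>r\<close> and \<open>s\<close>\<close>

text \<open>The sum of all inner degrees bounds each of them. This uniform bound makes the
  transposed coefficient array finitely supported in its new outer index.\<close>

lemma coeff_eventually_zero:
  fixes p :: "'a::zero poly poly"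
  obtains D where "\<And>i j. j > D \<Longrightarrow> coeff (coeff p i) j = 0"
proof
  fix i j
  assume "j > (\<Sum>i\<le>degree p. degree (coeff p i))"
  show "coeff (coeff p i) j = 0"
  proof (cases "i \<le> degree p")
    case True
    then have "degree (coeff p i) \<le> (\<Sum>i\<le>degree p. degree (coeff p i))"
      by (intro member_le_sum) auto
    then show ?thesis
      using \<open>j > _\<close> by (intro coeff_eq_0) simp
  qed (simp add: coeff_eq_0)
qed

text \<open>The inner variable stands for \<open>rh\<close> and the outer one for \<open>sh\<close>,
  so transposing the coefficient array exchanges the two square roots.\<close>

definition swap_poly :: "'a::zero poly poly \<Rightarrow> 'a poly poly" where
  "swap_poly p = Abs_poly (\<lambda>j. Abs_poly (\<lambda>i. coeff (coeff p i) j))"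

lemma coeff_swap_poly: "coeff (coeff (swap_poly p) j) i = coeff (coeff p i) j"
proof -
  obtain D where D: "\<And>i j. j > D \<Longrightarrow> coeff (coeff p i) j = 0"
    using coeff_eventually_zero [of p] by blast
  have inner: "coeff (Abs_poly (\<lambda>i. coeff (coeff p i) j)) = (\<lambda>i. coeff (coeff p i) j)" for j
    by (rule coeff_Abs_poly [of "degree p"]) (simp add: coeff_eq_0)
  have "coeff (swap_poly p) = (\<lambda>j. Abs_poly (\<lambda>i. coeff (coeff p i) j))"
    unfolding swap_poly_def
  proof (rule coeff_Abs_poly [of D])
    fix j assume "D < j"
    then show "Abs_poly (\<lambda>i. coeff (coeff p i) j) = 0"
      using inner [of j] by (simp add: D poly_eq_iff)
  qed
  then show ?thesis
    by (simp add: inner)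
qed

lemma poly_poly_eqI: "(\<And>i j. coeff (coeff p i) j = coeff (coeff q i) j) \<Longrightarrow> p = q"
  by (simp add: poly_eq_iff)

lemma swap_poly_swap_poly [simp]: "swap_poly (swap_poly p) = p"
  by (rule poly_poly_eqI) (simp add: coeff_swap_poly)

lemma swap_poly_0 [simp]: "swap_poly 0 = 0"
  by (rule poly_poly_eqI) (simp add: coeff_swap_poly)

lemma swap_poly_1 [simp]: "swap_poly 1 = (1 :: 'a::comm_semiring_1 poly poly)"
  by (rule poly_poly_eqI) (auto simp add: coeff_swap_poly)

lemma swap_poly_eq_0_iff [simp]: "swap_poly p = 0 \<longleftrightarrow> p = 0"
  by (metis swap_poly_0 swap_poly_swap_poly)

lemma swap_poly_add: "swap_poly (p + q) = swap_poly p + swap_poly q"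
  for p q :: "'a::comm_monoid_add poly poly"
  by (rule poly_poly_eqI) (simp add: coeff_swap_poly)

lemma swap_poly_mult: "swap_poly (p * q) = swap_poly p * swap_poly q"
  for p q :: "'a::comm_semiring_0 poly poly"
  by (rule poly_poly_eqI) (simp add: coeff_swap_poly coeff_mult coeff_sum, rule sum.swap)

lift_definition swap_K :: "K \<Rightarrow> K" is "\<lambda>(a, b). (swap_poly a, swap_poly b)"
  by (auto simp flip: swap_poly_mult)

lemma swap_K_swap_K [simp]: "swap_K (swap_K c) = c"
  by transfer auto

lemma swap_K_0 [simp]: "swap_K 0 = 0"
  by transfer auto

lemma swap_K_1 [simp]: "swap_K 1 = 1"
  by transfer auto

lemma swap_K_add: "swap_K (c + d) = swap_K c + swap_K d"
  by transfer (auto simp: swap_poly_add swap_poly_mult)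

lemma swap_K_mult: "swap_K (c * d) = swap_K c * swap_K d"
  by transfer (auto simp: swap_poly_mult)

lemma swap_K_uminus: "swap_K (- c) = - swap_K c"
  by (metis add.inverse_unique add.right_inverse swap_K_0 swap_K_add)

lemma swap_K_diff: "swap_K (c - d) = swap_K c - swap_K d"
  by (metis diff_conv_add_uminus swap_K_add swap_K_uminus)

lemma swap_K_inverse: "swap_K (inverse c) = inverse (swap_K c)"
proof (cases "c = 0")
  case False
  then have "swap_K c * swap_K (inverse c) = 1"
    by (simp flip: swap_K_mult)
  then show ?thesis
    using inverse_unique by fastforce
qed simp

lemma swap_K_divide: "swap_K (c / d) = swap_K c / swap_K d"
  by (simp add: divide_inverse swap_K_mult swap_K_inverse)

lemma swap_K_of_nat [simp]: "swap_K (of_nat m) = of_nat m"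
  by (induction m) (simp_all add: swap_K_add)

lemma swap_K_fact [simp]: "swap_K (fact k) = fact k"
  using swap_K_of_nat [of "fact k"] by (simp only: of_nat_fact)

lemma swap_K_of_int [simp]: "swap_K (of_int m) = of_int m"
  by (cases m) (simp_all add: swap_K_uminus swap_K_add swap_K_diff)

lemma swap_K_power: "swap_K (c ^ m) = swap_K c ^ m"
  by (induction m) (simp_all add: swap_K_mult)

lemma swap_K_powi: "swap_K (c powi m) = swap_K c powi m"
  by (simp add: power_int_def swap_K_power swap_K_inverse)

lemma swap_K_Fract: "b \<noteq> 0 \<Longrightarrow> swap_K (Fract a b) = Fract (swap_poly a) (swap_poly b)"
  by transfer auto

lemma swap_K_rh [simp]: "swap_K rh = sh" and swap_K_sh [simp]: "swap_K sh = rh"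
proof -
  have "swap_poly [:[:0, 1:]:] = ([:0, 1:] :: rat poly poly)"
    by (rule poly_poly_eqI) (auto simp: coeff_swap_poly coeff_pCons split: nat.splits)
  then show "swap_K rh = sh"
    by (simp add: rh_def sh_def swap_K_Fract)
  then show "swap_K sh = rh"
    by (metis swap_K_swap_K)
qed

lemma swap_K_r [simp]: "swap_K r = s" and swap_K_s [simp]: "swap_K s = r"
  by (simp_all add: r_def s_def swap_K_power)

lemma rh_nonzero [simp]: "rh \<noteq> 0" and sh_nonzero [simp]: "sh \<noteq> 0"
  by (simp_all add: rh_def sh_def Zero_fract_def eq_fract)

lemma r_nonzero [simp]: "r \<noteq> 0" and s_nonzero [simp]: "s \<noteq> 0"
  by (simp_all add: r_def s_def)

lemma r_neq_s [simp]: "r \<noteq> s" "s \<noteq> r"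
proof -
  show "r \<noteq> s"
    by (simp add: r_def s_def rh_def sh_def eq_fract power2_eq_square)
  then show "s \<noteq> r" by simp
qed

text \<open>The field is generated by \<open>rh\<close> and \<open>sh\<close> under ring operations
  and inversion, so a ring map is fixed on all scalars by its values there. The uniqueness of
  \<open>tau\<close> on scalars rests on this.\<close>

lemma K_induct [case_names one rh sh add mult inverse uminus]:
  fixes c :: K
  assumes one: "P 1" and rh: "P rh" and sh: "P sh"
    and add: "\<And>a b. P a \<Longrightarrow> P b \<Longrightarrow> P (a + b)"
    and mult: "\<And>a b. P a \<Longrightarrow> P b \<Longrightarrow> P (a * b)"
    and inverse: "\<And>a. P a \<Longrightarrow> a \<noteq> 0 \<Longrightarrow> P (inverse a)"
    and uminus: "\<And>a. P a \<Longrightarrow> P (- a)"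
  shows "P c"
proof -
  have zero: "P 0"
    using add [OF one uminus [OF one]] by simp
  have nat: "P (of_nat m)" for m
    by (induction m) (auto intro: zero one add)
  have int: "P (of_int m)" for m
    by (cases m) (use nat uminus [OF nat] in \<open>auto simp del: of_nat_Suc\<close>)
  have rat: "P (Fract [:[:q:]:] 1)" for q :: rat
  proof (cases q)
    case (Fract a b)
    have b: "of_int b = Fract [:[:of_int b:]:] (1 :: rat poly poly)" for b
      by (cases b) (simp_all add: of_nat_fract of_nat_poly del: of_nat_Suc)
    have "Fract [:[:q:]:] 1 = (of_int a * inverse (of_int b) :: K)"
      using Fract by (simp add: b eq_fract Fract_of_int_quotient one_pCons)
    moreover have "(of_int b :: K) \<noteq> 0"
      using Fract by (simp add: b Zero_fract_def eq_fract)
    ultimately show ?thesis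
      by (metis int mult inverse)
  qed
  have poly: "P (Fract [:p:] 1)" for p :: "rat poly"
  proof (induction p)
    case 0
    then show ?case using zero by (simp add: Zero_fract_def)
  next
    case (pCons a p)
    \<comment> \<open>Horner's scheme: \<open>rh\<close> is the inner variable, and
      \<open>sh\<close> plays the same role for the outer polynomial below.\<close>
    have "Fract [:pCons a p:] 1 = Fract [:[:a:]:] 1 + rh * Fract [:p:] 1"
      by (simp add: rh_def)
    then show ?case
      using pCons by (metis rat rh add mult)
  qed
  have poly2: "P (Fract p 1)" for p :: "rat poly poly"
  proof (induction p)
    case 0
    then show ?case using zero by (simp add: Zero_fract_def)
  next
    case (pCons a p)
    have "Fract (pCons a p) 1 = Fract [:a:] 1 + sh * Fract p 1"
      by (simp add: sh_def)
    then show ?case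
      using pCons by (metis poly sh add mult)
  qed
  obtain a b where c: "c = Fract a b" "b \<noteq> 0"
    by (cases c)
  then have "c = Fract a 1 * inverse (Fract b 1)" "Fract b 1 \<noteq> 0"
    by (simp_all add: Zero_fract_def eq_fract)
  then show ?thesis
    by (metis poly2 mult inverse)
qed

section \<open>The structure constants under the exchange of r and s\<close>

lemma eps_alpha_swap: "eps_alpha (j + 1) i = - eps_alpha i j"
  by (auto simp: eps_alpha_def)

lemma cartan_commute: "cartan i j = cartan j i"
  by (auto simp: cartan_def eps_alpha_def)

text \<open>Since (eps_{j+1}, alpha_i) = -(eps_i, alpha_j), interchanging the two exponents of <i,j>
  produces the negated exponents of <j,i>.\<close>

lemma swap_K_brh: "swap_K (brh i j) = inverse (brh j i)"
  unfolding brh_def eps_alpha_swap eps_alpha_swap [of i j]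
  by (simp add: swap_K_mult swap_K_powi swap_K_inverse eps_alpha_swap power_int_minus mult.commute)

lemma brh_nonzero [simp]: "brh i j \<noteq> 0"
  by (simp add: brh_def)

lemma swap_K_br: "swap_K (br i j) = inverse (br j i)"
  by (simp flip: brh_square add: swap_K_power swap_K_brh power_inverse)

lemma br_nonzero [simp]: "br i j \<noteq> 0"
  by (simp add: br_def)

lemma brh_diag: "brh i i = rh / sh"
  by (simp add: brh_def eps_alpha_def power_int_minus divide_inverse)

text \<open>The factor \<open>rh * sh\<close> is fixed, whereas <i,i> is inverted, so the two powers
  in the difference trade places.\<close>

lemma swap_K_acoeff: "swap_K (acoeff i j l) = - acoeff i j l"
  by (simp add: acoeff_def swap_K_mult swap_K_powi swap_K_diff swap_K_brh power_int_minus
      swap_K_inverse power_int_inverse mult.commute right_diff_distrib)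

lemma acoeff_commute: "acoeff i j l = acoeff j i l"
  by (simp add: acoeff_def brh_diag cartan_commute)

lemma acoeff_uminus: "acoeff i j (- l) = - acoeff i j l"
  by (simp add: acoeff_def algebra_simps)

section \<open>The antiautomorphism of the free algebra\<close>

text \<open>The sign is flipped only on \<open>XG\<close>, where it tells x^+ from x^-; in the other
  letters it is an exponent and stays.\<close>

primrec tau_letter :: "letter \<Rightarrow> letter" where
  "tau_letter (XG e i k) = XG (opp e) i (- k)"
| "tau_letter (AG i l) = AG i (- l)"
| "tau_letter (OmG e i) = OmG' e i"
| "tau_letter (OmG' e i) = OmG e i"
| "tau_letter (GamG e) = GamG' e"
| "tau_letter (GamG' e) = GamG e"
| "tau_letter (DG e) = DG' e"
| "tau_letter (DG' e) = DG e"

lemma opp_opp [simp]: "opp (opp e) = e"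
  by (cases e) auto

lemma sg_opp [simp]: "sg (opp e) = - sg e"
  by (cases e) auto

lemma tau_letter_tau_letter [simp]: "tau_letter (tau_letter g) = g"
  by (cases g) auto

lemma tau_letter_in_letters [simp]: "tau_letter g \<in> letters m \<longleftrightarrow> g \<in> letters m"
  by (cases g) (auto simp: letters_def)

lift_definition tau_word :: "'n word \<Rightarrow> 'n word" is "\<lambda>w. rev (map tau_letter w)"
  by auto

lemma tau_word_tau_word [simp]: "tau_word (tau_word w) = w"
  by transfer (simp add: rev_map o_def)

lemma tau_word_0 [simp]: "tau_word 0 = 0"
  by transfer simp

lemma tau_word_add: "tau_word (v + w) = tau_word w + tau_word v"
  by transfer simp

lemma tau_word_letter: "g \<in> letters CARD('n) \<Longrightarrow> tau_word (Abs_word [g] :: 'n word) = Abs_word [tau_letter g]"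
  by (simp add: tau_word_def Abs_word_inverse)

text \<open>As \<open>tau_word\<close> is an involution, pulling coefficients back along it is the
  same as pushing words forward. Applying \<open>swap_K\<close> makes the map semilinear.\<close>

lift_definition tau_free :: "'n free \<Rightarrow> 'n free" is "\<lambda>f w. swap_K (f (tau_word w))"
proof -
  fix f :: "'n word \<Rightarrow> K"
  assume "finite {w. f w \<noteq> 0}"
  then have "finite (tau_word ` {w. f w \<noteq> 0})"
    by simp
  moreover have "{w. swap_K (f (tau_word w)) \<noteq> 0} \<subseteq> tau_word ` {w. f w \<noteq> 0}"
    by (metis (mono_tags, lifting) image_eqI mem_Collect_eq subsetI swap_K_0 tau_word_tau_word)
  ultimately show "finite {w. swap_K (f (tau_word w)) \<noteq> 0}"
    by (rule rev_finite_subset)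
qed

lemma tau_free_tau_free [simp]: "tau_free (tau_free x) = x"
  by transfer simp

lemma tau_free_0 [simp]: "tau_free 0 = 0"
  by transfer simp

lemma tau_free_add: "tau_free (x + y) = tau_free x + tau_free y"
  by transfer (simp add: swap_K_add)

lemma tau_free_uminus: "tau_free (- x) = - tau_free x"
  by transfer (simp add: swap_K_uminus fun_eq_iff)

lemma tau_free_diff: "tau_free (x - y) = tau_free x - tau_free y"
  by transfer (simp add: swap_K_diff)

lemma tau_free_single: "tau_free (Poly_Mapping.single w c) = Poly_Mapping.single (tau_word w) (swap_K c)"
  by transfer (auto simp: fun_eq_iff when_def)

lemma poly_mapping_add_induct [case_names add single]:
  fixes x :: "'a \<Rightarrow>\<^sub>0 'b::comm_monoid_add"
  assumes "\<And>x y. P x \<Longrightarrow> P y \<Longrightarrow> P (x + y)" and "\<And>w c. P (Poly_Mapping.single w c)"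
  shows "P x"
proof (induction x rule: Poly_Mapping.update_induct)
  case const
  then show ?case using assms(2) [of undefined 0] by simp
next
  case (update f a b)
  have "Poly_Mapping.update a b f = f + Poly_Mapping.single a b"
    using update.hyps
    by (intro poly_mapping_eqI) (auto simp: lookup_update lookup_add lookup_single when_def in_keys_iff)
  then show ?case
    using assms update.IH by simp
qed

lemma tau_free_mult: "tau_free (x * y) = tau_free y * tau_free x"
proof (induction x rule: poly_mapping_add_induct)
  case (add x x')
  then show ?case by (simp add: tau_free_add algebra_simps)
next
  case (single v c)
  show ?case
  proof (induction y rule: poly_mapping_add_induct)
    case (add y y')
    then show ?case by (simp add: tau_free_add algebra_simps)
  next
    case (single w d)
    show ?case
      by (simp add: tau_free_single mult_single tau_word_add swap_K_mult mult.commute)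
  qed
qed

lemma tau_free_sum: "tau_free (\<Sum>i\<in>A. f i) = (\<Sum>i\<in>A. tau_free (f i))"
  by (induction A rule: infinite_finite_induct) (simp_all add: tau_free_add)

lemma tau_free_scalf: "tau_free (scalf c) = scalf (swap_K c)"
  by (simp add: scalf_def tau_free_single)

lemma tau_free_1 [simp]: "tau_free 1 = 1"
  by (simp flip: single_one add: tau_free_single)

lemma tau_free_genf: "tau_free (genf g) = genf (tau_letter g)"
  by (simp add: genf_def tau_free_single tau_word_letter)

lemma tau_free_power: "tau_free (x ^ k) = tau_free x ^ k"
  by (induction k) (simp_all add: tau_free_mult power_commutes)

lemma tau_free_gamf: "tau_free (gamf m) = gamf' m" "tau_free (gamf' m) = gamf m"
  by (simp_all add: gamf_def gamf'_def tau_free_power tau_free_genf)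

lemma scalf_central: "scalf c * x = x * scalf c"
proof (induction x rule: poly_mapping_add_induct)
  case (add x x')
  then show ?case by (simp add: algebra_simps)
next
  case (single w d)
  show ?case by (simp add: scalf_def mult_single mult.commute)
qed

section \<open>The exponential generating series under reversal\<close>

lemma fps_nth_tau_power:
  "fps_nth (Abs_fps (\<lambda>m. tau_free (fps_nth f m)) ^ k) m = tau_free (fps_nth (f ^ k) m)"
proof (induction k arbitrary: m)
  case (Suc k)
  have "fps_nth (Abs_fps (\<lambda>m. tau_free (fps_nth f m)) ^ Suc k) m
    = (\<Sum>i=0..m. tau_free (fps_nth f i) * tau_free (fps_nth (f ^ k) (m - i)))"
    by (simp add: fps_mult_nth Suc)
  \<comment> \<open>Reversal reads the Cauchy sum backwards and turns \<open>f * f ^ k\<close> into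
    \<open>f ^ k * f\<close>; both are \<open>f ^ Suc k\<close>, although the coefficients of
    \<open>f\<close> need not commute.\<close>
  also have "\<dots> = tau_free (fps_nth (f ^ k * f) m)"
    unfolding fps_mult_nth tau_free_sum tau_free_mult
    by (rule sum.reindex_bij_witness [where i = "\<lambda>i. m - i" and j = "\<lambda>i. m - i"]) auto
  finally show ?case
    by (simp add: power_commutes)
qed simp

lemma tau_free_exp_coeff:
  "tau_free (exp_coeff f m) = exp_coeff (Abs_fps (\<lambda>m. tau_free (fps_nth f m))) m"
  by (simp add: exp_coeff_def tau_free_sum tau_free_mult tau_free_scalf swap_K_divide swap_K_fact
      fps_nth_tau_power flip: scalf_central)

abbreviation a_series :: "nat \<Rightarrow> 'n free fps" where
  "a_series i \<equiv> Abs_fps (\<lambda>l. if l = 0 then 0 else scalf (r - s) * genf (AG i (int l)))"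

abbreviation a_series' :: "nat \<Rightarrow> 'n free fps" where
  "a_series' i \<equiv> Abs_fps (\<lambda>l. if l = 0 then 0 else scalf (- (r - s)) * genf (AG i (- int l)))"

text \<open>Negating both \<open>r - s\<close> and the modes turns the exponent of omega_i into that
  of omega'_i. The torus letter ends up on the right; moving it back uses relations of the
  quotient.\<close>

lemma tau_free_om_mode:
  "tau_free (om_mode i m :: 'n free) =
     (if m < 0 then 0 else exp_coeff (a_series' i) (nat m) * genf (OmG' Plus i))"
proof -
  have "Abs_fps (\<lambda>m. tau_free (fps_nth (a_series i) m)) = (a_series' i :: 'n free fps)"
    by (auto simp: fps_eq_iff tau_free_mult tau_free_scalf tau_free_genf scalf_central swap_K_diff)
  then have "tau_free (exp_coeff (a_series i) k) = (exp_coeff (a_series' i) k :: 'n free)" for k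
    by (simp only: tau_free_exp_coeff)
  then show ?thesis
    by (simp add: om_mode_def tau_free_mult tau_free_genf)
qed

lemma tau_free_om_mode':
  "tau_free (om_mode' i m :: 'n free) =
     (if m > 0 then 0 else exp_coeff (a_series i) (nat (- m)) * genf (OmG Plus i))"
proof -
  have "Abs_fps (\<lambda>m. tau_free (fps_nth (a_series' i) m)) = (a_series i :: 'n free fps)"
    by (auto simp: fps_eq_iff tau_free_mult tau_free_scalf tau_free_genf scalf_central swap_K_diff)
  then have "tau_free (exp_coeff (a_series' i) k) = (exp_coeff (a_series i) k :: 'n free)" for k
    by (simp only: tau_free_exp_coeff)
  then show ?thesis
    by (simp add: om_mode'_def tau_free_mult tau_free_genf)
qed

section \<open>The relations in the quotient\<close>

lemma abs_qaff_hom: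
  "abs_qaff (x + y) = abs_qaff x + abs_qaff y"
  "abs_qaff (x - y) = abs_qaff x - abs_qaff y"
  "abs_qaff (- x) = - abs_qaff x"
  "abs_qaff (x * y) = abs_qaff x * abs_qaff y"
  "abs_qaff 0 = 0" "abs_qaff 1 = 1"
  "abs_qaff (scalf c) = scal c" "abs_qaff (genf g) = gen g"
  by (simp_all add: plus_qaff.abs_eq minus_qaff.abs_eq uminus_qaff.abs_eq times_qaff.abs_eq
      zero_qaff_def one_qaff_def scal_def gen_def)

lemma abs_qaff_sum: "abs_qaff (\<Sum>i\<in>A. f i) = (\<Sum>i\<in>A. abs_qaff (f i))"
  by (induction A rule: infinite_finite_induct) (simp_all add: abs_qaff_hom)

lemma abs_qaff_power: "abs_qaff (x ^ k) = abs_qaff x ^ k"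
  by (induction k) (simp_all add: abs_qaff_hom)

lemma abs_qaff_if: "abs_qaff (if P then x else y) = (if P then abs_qaff x else abs_qaff y)"
  by simp

lemma rel_imp_eq: "rel x y \<Longrightarrow> abs_qaff x = abs_qaff y"
  by (simp add: qaff.abs_eq_iff cong_rel_def rel_ideal.rel)

lemma qaff_cases: obtains x where "y = abs_qaff x"
  by (metis Quotient_qaff Quotient_abs_rep)

lemma scal_mult: "scal (c * d) = scal c * scal d"
  by transfer (simp add: scalf_def mult_single cong_rel_def rel_ideal.zero)

lemma scal_add: "scal (c + d) = scal c + scal d"
  by transfer (simp add: scalf_def single_add cong_rel_def rel_ideal.zero)

lemma scal_uminus: "scal (- c) = - scal c"
  by transfer (simp add: scalf_def single_uminus cong_rel_def rel_ideal.zero)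

lemma scal_diff: "scal (c - d) = scal c - scal d"
  by (simp add: scal_add scal_uminus flip: add_uminus_conv_diff)

lemma scal_1 [simp]: "scal 1 = 1"
  by transfer (simp add: scalf_def cong_rel_def rel_ideal.zero)

lemma scal_central: "scal c * x = x * scal c"
  by transfer (simp add: scalf_central cong_rel_def rel_ideal.zero)

lemma scal_scal [simp]: "scal c * scal d = scal (c * d)" "scal c * (scal d * x) = scal (c * d) * x"
  by (simp_all add: scal_mult mult.assoc)

text \<open>The \<open>NO_MATCH\<close> guard lets the simplifier move scalars to the left without
  permuting two scalars forever.\<close>

lemma scal_right:
  "NO_MATCH (scal d) x \<Longrightarrow> x * scal c = scal c * x"
  "NO_MATCH (scal d) x \<Longrightarrow> x * (scal c * y) = scal c * (x * y)"
  by (rule scal_central [symmetric], metis mult.assoc scal_central)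

definition gam :: "int \<Rightarrow> 'n qaff" where "gam m = abs_qaff (gamf m)"
definition gam' :: "int \<Rightarrow> 'n qaff" where "gam' m = abs_qaff (gamf' m)"

lemma gam_eq:
  "gam m = (if 0 \<le> m then gen (GamG Plus) ^ nat m else gen (GamG Minus) ^ nat (- m))"
  "gam' m = (if 0 \<le> m then gen (GamG' Plus) ^ nat m else gen (GamG' Minus) ^ nat (- m))"
  by (simp_all add: gam_def gam'_def gamf_def gamf'_def abs_qaff_power abs_qaff_hom)

lemma gamma_central_qaff:
  "gen (GamG e) * y = y * gen (GamG e)" "gen (GamG' e) * y = y * gen (GamG' e)"
proof -
  obtain x where y: "y = abs_qaff x"
    by (rule qaff_cases)
  show "gen (GamG e) * y = y * gen (GamG e)" "gen (GamG' e) * y = y * gen (GamG' e)"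
    unfolding y
    by (rule rel_imp_eq [OF rel.gamma_central, unfolded abs_qaff_hom],
        rule rel_imp_eq [OF rel.gamma'_central, unfolded abs_qaff_hom])
qed

lemma gam_central: "gam m * y = y * gam m" "gam' m * y = y * gam' m"
  unfolding gam_eq by (auto intro!: power_commuting_commutes gamma_central_qaff)

lemma gamma_inverse_qaff:
  "gen (GamG e) * gen (GamG (opp e)) = 1" "gen (GamG' e) * gen (GamG' (opp e)) = 1"
  using rel_imp_eq [OF rel.gamma_inverse] rel_imp_eq [OF rel.gamma'_inverse]
  by (simp_all add: abs_qaff_hom)

lemma gamma_product_qaff: "gen (GamG Plus) * gen (GamG' Plus) = scal (rh * sh)"
  using rel_imp_eq [OF rel.gamma_product] by (simp add: abs_qaff_hom)

context
  fixes i :: nat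
  assumes i: "i \<in> nodes CARD('n)"
begin

lemma omega_inverse_qaff:
  "gen (OmG e i) * gen (OmG (opp e) i) = (1 :: 'n qaff)"
  "gen (OmG' e i) * gen (OmG' (opp e) i) = (1 :: 'n qaff)"
  using rel_imp_eq [OF rel.omega_inverse [OF i]] rel_imp_eq [OF rel.omega'_inverse [OF i]]
  by (simp_all add: abs_qaff_hom)

lemma D_x_qaff:
  "gen (DG Plus) * gen (XG e i k) * gen (DG Minus) = scal (r powi k) * (gen (XG e i k) :: 'n qaff)"
  "gen (DG' Plus) * gen (XG e i k) * gen (DG' Minus) = scal (s powi k) * (gen (XG e i k) :: 'n qaff)"
  using rel_imp_eq [OF rel.D_x [OF i]] rel_imp_eq [OF rel.D'_x [OF i]]
  by (simp_all only: abs_qaff_hom)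

lemma D_a_qaff:
  assumes "l \<noteq> 0"
  shows "gen (DG Plus) * gen (AG i l) * gen (DG Minus) = scal (r powi l) * (gen (AG i l) :: 'n qaff)"
    and "gen (DG' Plus) * gen (AG i l) * gen (DG' Minus) = scal (s powi l) * (gen (AG i l) :: 'n qaff)"
  using rel_imp_eq [OF rel.D_a [OF i assms]] rel_imp_eq [OF rel.D'_a [OF i assms]]
  by (simp_all only: abs_qaff_hom)

end

context
  fixes i j :: nat
  assumes i: "i \<in> nodes CARD('n)" and j: "j \<in> nodes CARD('n)"
begin

lemma omega_x_qaff:
  "gen (OmG Plus i) * gen (XG e j k) * gen (OmG Minus i) = scal (br j i powi sg e) * (gen (XG e j k) :: 'n qaff)"
  "gen (OmG' Plus i) * gen (XG e j k) * gen (OmG' Minus i) = scal (br i j powi (- sg e)) * (gen (XG e j k) :: 'n qaff)"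
  using rel_imp_eq [OF rel.omega_x [OF i j]] rel_imp_eq [OF rel.omega'_x [OF i j]]
  by (simp_all add: abs_qaff_hom)

lemma a_a_qaff:
  assumes "l \<noteq> 0" "l' \<noteq> 0"
  shows "gen (AG i l) * gen (AG j l') - gen (AG j l') * gen (AG i l) =
     (if l + l' = 0
       then scal (acoeff i j l / (of_int \<bar>l\<bar> * (r - s)) / (r - s)) *
         (gam (2 * \<bar>l\<bar>) - gam' (2 * \<bar>l\<bar>))
       else 0 :: 'n qaff)"
  using rel_imp_eq [OF rel.a_a [OF i j assms]]
  by (simp only: abs_qaff_hom abs_qaff_if gam_def gam'_def)

lemma a_omega_qaff:
  assumes "l \<noteq> 0"
  shows "gen (AG i l) * gen (OmG e j) = (gen (OmG e j) * gen (AG i l) :: 'n qaff)"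
    and "gen (AG i l) * gen (OmG' e j) = (gen (OmG' e j) * gen (AG i l) :: 'n qaff)"
  by (rule rel_imp_eq [OF rel.a_omega [OF i j assms], unfolded abs_qaff_hom],
      rule rel_imp_eq [OF rel.a_omega' [OF i j assms], unfolded abs_qaff_hom])

lemma a_x_qaff:
  assumes "l \<noteq> 0"
  shows "gen (AG i l) * gen (XG e j k) - gen (XG e j k) * gen (AG i l) =
      (scal (of_int (sg e) * acoeff i j l / (of_int l * (r - s))) *
       (if l < 0 then gam (sg e * l) else gam' (sg e * l)) * gen (XG e j (l + k)) :: 'n qaff)"
  using rel_imp_eq [OF rel.a_x [OF i j assms]]
  by (simp only: abs_qaff_hom abs_qaff_if gam_def gam'_def)

lemma x_x_qaff:
  "gen (XG e i (k + 1)) * gen (XG e j k')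
     - scal (br j i powi sg e) * gen (XG e j k') * gen (XG e i (k + 1)) =
   (- scal ((brh j i / brh i j) powi sg e) *
       (gen (XG e j (k' + 1)) * gen (XG e i k)
        - scal (br i j powi sg e) * gen (XG e i k) * gen (XG e j (k' + 1))) :: 'n qaff)"
  using rel_imp_eq [OF rel.x_x [OF i j]]
  by (simp only: abs_qaff_hom)

lemma xplus_xminus_qaff:
  "gen (XG Plus i k) * gen (XG Minus j k') - gen (XG Minus j k') * gen (XG Plus i k) =
      (if i = j
       then scal (1 / (r - s)) *
         (gam' (- 2 * k) * gam (- (k + k')) * abs_qaff (om_mode i (k + k'))
          - gam (2 * k') * gam' (k + k') * abs_qaff (om_mode' i (k + k')))
       else 0 :: 'n qaff)"
  using rel_imp_eq [OF rel.xplus_xminus [OF i j]]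
  by (simp only: abs_qaff_hom abs_qaff_if gam_def gam'_def)

lemma x_commute_qaff:
  "cartan i j = 0 \<Longrightarrow> gen (XG e i m) * gen (XG e j k) = (gen (XG e j k) * gen (XG e i m) :: 'n qaff)"
  by (rule rel_imp_eq [OF rel.x_commute [OF i j], unfolded abs_qaff_hom])

end

lemma torus_commute_qaff:
  "g \<in> torus CARD('n) \<Longrightarrow> h \<in> torus CARD('n) \<Longrightarrow> gen g * gen h = (gen h * gen g :: 'n qaff)"
  by (rule rel_imp_eq [OF rel.torus_commute, unfolded abs_qaff_hom])

lemma D_inverse_qaff:
  "gen (DG e) * gen (DG (opp e)) = 1" "gen (DG' e) * gen (DG' (opp e)) = 1"
  using rel_imp_eq [OF rel.D_inverse] rel_imp_eq [OF rel.D'_inverse]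
  by (simp_all only: abs_qaff_hom)

definition serre_qaff :: "sgn \<Rightarrow> nat \<Rightarrow> nat \<Rightarrow> K \<Rightarrow> K \<Rightarrow> int \<Rightarrow> int \<Rightarrow> int \<Rightarrow> 'n qaff" where
  "serre_qaff e i j p q m1 m2 k =
     gen (XG e i m1) * gen (XG e i m2) * gen (XG e j k)
     - scal (p + q) * gen (XG e i m1) * gen (XG e j k) * gen (XG e i m2)
     + scal (p * q) * gen (XG e j k) * gen (XG e i m1) * gen (XG e i m2)"

lemma x_serre_qaff:
  assumes "i \<in> nodes CARD('n)" "j \<in> nodes CARD('n)" "cartan i j = - 1"
    and "t = (if i < j then sg e else - sg e)"
  shows "serre_qaff e i j (r powi t) (s powi t) m1 m2 k
    + serre_qaff e i j (r powi t) (s powi t) m2 m1 k = (0 :: 'n qaff)"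
  using rel_imp_eq [OF rel.x_serre [OF assms]]
  unfolding serre_def serre_qaff_def by (simp only: abs_qaff_hom)

lemma commute_mult:
  fixes w x y :: "'a::semigroup_mult"
  shows "x * w = w * x \<Longrightarrow> y * w = w * y \<Longrightarrow> x * y * w = w * (x * y)"
  by (metis mult.assoc)

lemma exp_coeff_commute:
  assumes f: "\<And>l. abs_qaff (fps_nth f l) * w = w * abs_qaff (fps_nth f l)"
  shows "abs_qaff (exp_coeff f m) * w = w * abs_qaff (exp_coeff f m)"
proof -
  have pow: "abs_qaff (fps_nth (f ^ k) m) * w = w * abs_qaff (fps_nth (f ^ k) m)" for k m
  proof (induction k arbitrary: m)
    case (Suc k)
    show ?case
      unfolding power_Suc fps_mult_nth abs_qaff_sum sum_distrib_left sum_distrib_right abs_qaff_hom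
      by (rule sum.cong [OF refl], rule commute_mult, rule f, rule Suc)
  qed (simp add: abs_qaff_hom)
  show ?thesis
    unfolding exp_coeff_def abs_qaff_sum sum_distrib_left sum_distrib_right abs_qaff_hom
    by (rule sum.cong [OF refl], rule commute_mult, rule scal_central, rule pow)
qed

section \<open>Invariance of the relations\<close>

text \<open>With the projection composed in, invariance of the relations can be checked as
  equalities in the quotient; \<open>tau_free\<close> descends once these hold.\<close>

definition tau_pre :: "'n free \<Rightarrow> 'n qaff" where
  "tau_pre x = abs_qaff (tau_free x)"

lemma tau_pre_hom:
  "tau_pre (x + y) = tau_pre x + tau_pre y"
  "tau_pre (x - y) = tau_pre x - tau_pre y"
  "tau_pre (- x) = - tau_pre x"
  "tau_pre (x * y) = tau_pre y * tau_pre x"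
  "tau_pre 0 = 0" "tau_pre 1 = 1"
  "tau_pre (scalf c) = scal (swap_K c)" "tau_pre (genf g) = gen (tau_letter g)"
  "tau_pre (gamf m) = gam' m" "tau_pre (gamf' m) = gam m"
  by (simp_all add: tau_pre_def tau_free_add tau_free_diff tau_free_uminus tau_free_mult
      tau_free_scalf tau_free_genf tau_free_gamf gam_def gam'_def abs_qaff_hom)

lemma abs_qaff_om_mode:
  "abs_qaff (om_mode i m :: 'n free) =
    (if m < 0 then 0 else gen (OmG Plus i) * abs_qaff (exp_coeff (a_series i) (nat m)))"
  "abs_qaff (om_mode' i m :: 'n free) =
    (if m > 0 then 0 else gen (OmG' Plus i) * abs_qaff (exp_coeff (a_series' i) (nat (- m))))"
  by (simp_all add: om_mode_def om_mode'_def abs_qaff_hom)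

text \<open>All a_i(l) commute with omega_i and omega'_i, which brings the torus factor displaced by
  reversal back to the front.\<close>

lemma exp_coeff_a_series_commute:
  assumes i: "i \<in> nodes CARD('n)"
  shows "abs_qaff (exp_coeff (a_series i) m) * gen (OmG Plus i) =
      (gen (OmG Plus i) * abs_qaff (exp_coeff (a_series i) m) :: 'n qaff)"
    and "abs_qaff (exp_coeff (a_series' i) m) * gen (OmG' Plus i) =
      (gen (OmG' Plus i) * abs_qaff (exp_coeff (a_series' i) m) :: 'n qaff)"
proof -
  have "scal c * gen (AG i l) * gen (OmG Plus i) = (gen (OmG Plus i) * (scal c * gen (AG i l)) :: 'n qaff)"
    "scal c * gen (AG i l) * gen (OmG' Plus i) = (gen (OmG' Plus i) * (scal c * gen (AG i l)) :: 'n qaff)"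
    if "l \<noteq> 0" for c l
    by (rule commute_mult, rule scal_central, rule a_omega_qaff [OF i i that])+
  then show "abs_qaff (exp_coeff (a_series i) m) * gen (OmG Plus i) =
      (gen (OmG Plus i) * abs_qaff (exp_coeff (a_series i) m) :: 'n qaff)"
    "abs_qaff (exp_coeff (a_series' i) m) * gen (OmG' Plus i) =
      (gen (OmG' Plus i) * abs_qaff (exp_coeff (a_series' i) m) :: 'n qaff)"
    by (auto intro!: exp_coeff_commute simp: abs_qaff_hom simp del: minus_diff_eq)
qed

lemma tau_pre_om_mode:
  assumes "i \<in> nodes CARD('n)"
  shows "tau_pre (om_mode i m :: 'n free) = abs_qaff (om_mode' i (- m))"
    and "tau_pre (om_mode' i m :: 'n free) = abs_qaff (om_mode i (- m))"
  unfolding tau_pre_def tau_free_om_mode tau_free_om_mode' abs_qaff_om_mode abs_qaff_if abs_qaff_hom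
  by (simp_all only: exp_coeff_a_series_commute [OF assms] minus_minus neg_less_0_iff_less neg_0_less_iff_less)

text \<open>Reversal turns conjugation by an element into conjugation by an inverse, so the
  conjugation relations for the torus are needed in this inverted form.\<close>

lemma inverse_conj:
  assumes "u * v = (1 :: 'n qaff)" "v * u = 1" "u * x * v = scal c * x" "c \<noteq> 0"
  shows "v * x * u = scal (inverse c) * x"
proof -
  have "x = v * (u * x * v) * u"
    using assms(1,2) by (metis mult.assoc mult_1_left mult_1_right)
  also have "\<dots> = scal c * (v * x * u)"
    unfolding assms(3) by (simp add: mult.assoc scal_right)
  finally have "scal (inverse c) * x = scal (inverse c) * (scal c * (v * x * u))"
    by (rule arg_cong)
  then show ?thesis
    using assms(4) by simp
qed

lemma inverse_pairs:
  "gen (DG Plus) * gen (DG Minus) = 1" "gen (DG Minus) * gen (DG Plus) = 1"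
  "gen (DG' Plus) * gen (DG' Minus) = 1" "gen (DG' Minus) * gen (DG' Plus) = 1"
  using D_inverse_qaff [of Plus] D_inverse_qaff [of Minus] by simp_all

lemma omega_inverse_pairs:
  assumes "i \<in> nodes CARD('n)"
  shows "gen (OmG Plus i) * gen (OmG Minus i) = (1 :: 'n qaff)"
    "gen (OmG Minus i) * gen (OmG Plus i) = (1 :: 'n qaff)"
    "gen (OmG' Plus i) * gen (OmG' Minus i) = (1 :: 'n qaff)"
    "gen (OmG' Minus i) * gen (OmG' Plus i) = (1 :: 'n qaff)"
  using omega_inverse_qaff [OF assms, of Plus] omega_inverse_qaff [OF assms, of Minus] by simp_all

text \<open>Multiplying by \<open>p * q\<close> exchanges the outer coefficients of the Serre
  polynomial with parameters 1/p and 1/q. This is the form in which reversal delivers the polynomial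
  for \<open>p\<close> and \<open>q\<close>.\<close>

lemma serre_qaff_rescale:
  assumes "p \<noteq> 0" "q \<noteq> 0"
  shows "scal (p * q) * (serre_qaff e i j (inverse p) (inverse q) m1 m2 k :: 'n qaff) =
     gen (XG e j k) * gen (XG e i m1) * gen (XG e i m2)
     - scal (p + q) * gen (XG e i m1) * gen (XG e j k) * gen (XG e i m2)
     + scal (p * q) * gen (XG e i m1) * gen (XG e i m2) * gen (XG e j k)"
proof -
  have *: "p * q * (inverse p + inverse q) = p + q" "p * q * (inverse p * inverse q) = 1"
    using assms by (simp_all add: field_simps)
  have "scal (p * q) * serre_qaff e i j (inverse p) (inverse q) m1 m2 k =
     (scal (p * q) * gen (XG e i m1) * gen (XG e i m2) * gen (XG e j k)
     - scal (p * q * (inverse p + inverse q)) * gen (XG e i m1) * gen (XG e j k) * gen (XG e i m2)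
     + scal (p * q * (inverse p * inverse q)) * gen (XG e j k) * gen (XG e i m1) * gen (XG e i m2) :: 'n qaff)"
    unfolding serre_qaff_def
    by (simp only: right_diff_distrib distrib_left [of "scal (p * q)"] mult.assoc scal_scal)
  moreover have "x - y + z = z - y + x" for x y z :: "'n qaff"
    by (simp add: algebra_simps)
  ultimately show ?thesis
    unfolding * by simp
qed

lemma swap_K_r_diff_s: "swap_K (r - s) = - (r - s)"
  by (simp add: swap_K_diff)

lemma scal_gam_reverse:
  "x * (gam m * scal c) = scal c * gam m * x" "x * (gam' m * scal c) = scal c * gam' m * x"
  by (metis mult.assoc scal_central gam_central(1), metis mult.assoc scal_central gam_central(2))

text \<open>Each relation goes over to one of the same family or of its primed partner, at negated
  modes; what has to be compared are the scalars and signs.\<close>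

lemma tau_pre_eq_if_rel:
  fixes x y :: "'n free"
  assumes "rel x y"
  shows "tau_pre x = tau_pre y"
  using assms
proof cases
  case (gamma_central e z)
  then show ?thesis by (simp only: tau_pre_hom tau_letter.simps gamma_central_qaff)
next
  case (gamma'_central e z)
  then show ?thesis by (simp only: tau_pre_hom tau_letter.simps gamma_central_qaff)
next
  case (gamma_inverse e)
  then show ?thesis
    using gamma_inverse_qaff [of "opp e"] by (simp add: tau_pre_hom)
next
  case (gamma'_inverse e)
  then show ?thesis
    using gamma_inverse_qaff [of "opp e"] by (simp add: tau_pre_hom)
next
  case gamma_product
  then show ?thesis
    using gamma_product_qaff
    by (simp add: tau_pre_hom swap_K_mult mult.commute)
next
  case (torus_commute g h)
  then have "tau_letter g \<in> torus CARD('n)" "tau_letter h \<in> torus CARD('n)"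
    by (auto simp: torus_def)
  with torus_commute show ?thesis
    by (simp only: tau_pre_hom) (rule torus_commute_qaff)
next
  case (omega_inverse i e)
  then show ?thesis
    using omega_inverse_qaff [of i "opp e"] by (simp add: tau_pre_hom)
next
  case (omega'_inverse i e)
  then show ?thesis
    using omega_inverse_qaff [of i "opp e"] by (simp add: tau_pre_hom)
next
  case (D_inverse e)
  then show ?thesis
    using D_inverse_qaff [of "opp e"] by (simp add: tau_pre_hom)
next
  case (D'_inverse e)
  then show ?thesis
    using D_inverse_qaff [of "opp e"] by (simp add: tau_pre_hom)
next
  case (a_a i j l l')
  show ?thesis
  proof (cases "l + l' = 0")
    case True
    then have l': "l' = - l" by simp
    define c where "c = acoeff j i l / (of_int \<bar>l\<bar> * (r - s)) / (r - s)"
    \<comment> \<open>\<open>acoeff\<close> changes sign while the square of \<open>r - s\<close>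
      does not; this sign matches the exchange of gamma and gamma' in the last factor.\<close>
    have c: "swap_K (acoeff i j l / (of_int \<bar>l\<bar> * (r - s)) / (r - s)) = - c"
      by (simp add: c_def swap_K_divide swap_K_mult swap_K_acoeff swap_K_r_diff_s
          acoeff_commute [of i j] del: of_int_abs minus_diff_eq)
    have "tau_pre x = gen (AG j l) * gen (AG i (- l)) - gen (AG i (- l)) * gen (AG j l)"
      by (simp add: a_a(1) l' tau_pre_hom)
    also have "\<dots> = scal c * (gam (2 * \<bar>l\<bar>) - gam' (2 * \<bar>l\<bar>))"
      using a_a by (subst a_a_qaff) (simp_all add: c_def)
    also have "\<dots> = (gam' (2 * \<bar>l\<bar>) - gam (2 * \<bar>l\<bar>)) * scal (- c)"
      by (simp add: scal_uminus scal_right algebra_simps)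
    also have "\<dots> = tau_pre y"
      using True by (simp only: a_a(2) tau_pre_hom c if_True simp_thms)
    finally show ?thesis .
  next
    case False
    then show ?thesis
      using a_a a_a_qaff [where 'n = 'n, of j i "- l'" "- l"] unfolding a_a(1,2)
      by (simp add: tau_pre_hom)
  qed
next
  case (a_omega i j l e)
  then show ?thesis
    by (simp only: tau_pre_hom tau_letter.simps) (rule a_omega_qaff(2) [symmetric], simp_all)
next
  case (a_omega' i j l e)
  then show ?thesis
    by (simp only: tau_pre_hom tau_letter.simps) (rule a_omega_qaff(1) [symmetric], simp_all)
next
  case (D_x i e k)
  \<comment> \<open>Reversal puts the inverse of D' on the left, so the D' relation for the opposite
    sign and mode \<open>- k\<close> enters in inverted form.\<close>
  then show ?thesis
    using inverse_conj [OF inverse_pairs(3,4) D_x_qaff(2) [of i "opp e" "- k"]]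
    by (simp add: tau_pre_hom swap_K_powi power_int_minus scal_right mult.assoc)
next
  case (D'_x i e k)
  then show ?thesis
    using inverse_conj [OF inverse_pairs(1,2) D_x_qaff(1) [of i "opp e" "- k"]]
    by (simp add: tau_pre_hom swap_K_powi power_int_minus scal_right mult.assoc)
next
  case (D_a i l)
  then show ?thesis
    using inverse_conj [OF inverse_pairs(3,4) D_a_qaff(2) [of i "- l"]]
    by (simp add: tau_pre_hom swap_K_powi power_int_minus scal_right mult.assoc)
next
  case (D'_a i l)
  then show ?thesis
    using inverse_conj [OF inverse_pairs(1,2) D_a_qaff(1) [of i "- l"]]
    by (simp add: tau_pre_hom swap_K_powi power_int_minus scal_right mult.assoc)
next
  case (omega_x i j e k)
  then show ?thesis
    using inverse_conj [OF omega_inverse_pairs(3,4) omega_x_qaff(2) [where 'n = 'n, of i j "opp e" "- k"]]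
    by (simp add: tau_pre_hom swap_K_powi swap_K_br swap_K_inverse power_int_inverse scal_right mult.assoc)
next
  case (omega'_x i j e k)
  then show ?thesis
    using inverse_conj [OF omega_inverse_pairs(1,2) omega_x_qaff(1) [where 'n = 'n, of i j "opp e" "- k"]]
    by (simp add: tau_pre_hom swap_K_powi swap_K_br swap_K_inverse power_int_inverse power_int_minus scal_right mult.assoc)
next
  case (a_x i j l e k)
  define c where "c = of_int (sg (opp e)) * acoeff i j (- l) / (of_int (- l) * (r - s))"
  \<comment> \<open>Both \<open>acoeff\<close> and \<open>r - s\<close> change sign, so the original
    coefficient is fixed by \<open>swap_K\<close>; it is the negative of \<open>c\<close>, and this
    sign pays for the reversed commutator.\<close>
  have c: "swap_K (of_int (sg e) * acoeff i j l / (of_int l * (r - s))) = - c"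
    unfolding c_def
    by (simp add: swap_K_divide swap_K_mult swap_K_r_diff_s swap_K_acoeff acoeff_uminus
        del: minus_diff_eq)
  have "tau_pre x = - (gen (AG i (- l)) * gen (XG (opp e) j (- k))
      - gen (XG (opp e) j (- k)) * gen (AG i (- l)))"
    by (simp add: a_x(1) tau_pre_hom)
  also have "\<dots> = - (scal c * (if - l < 0 then gam (sg (opp e) * - l) else gam' (sg (opp e) * - l)) *
      gen (XG (opp e) j (- l + - k)))"
    unfolding c_def using a_x by (subst a_x_qaff) simp_all
  also have "\<dots> = scal (- c) * (if l < 0 then gam' (sg e * l) else gam (sg e * l)) *
      gen (XG (opp e) j (- (l + k)))"
    using \<open>l \<noteq> 0\<close> by (cases "l < 0") (simp_all add: scal_uminus)
  also have "\<dots> = tau_pre y"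
    unfolding a_x(2) by (cases "l < 0") (simp_all only: if_True if_False tau_pre_hom c scal_gam_reverse tau_letter.simps)
  finally show ?thesis .
next
  case (x_x i j e k k')
  let ?X = "\<lambda>i k. gen (XG (opp e) i k) :: 'n qaff"
  let ?d = "brh j i / brh i j"
  \<comment> \<open>The relation at modes \<open>- k - 1\<close> and \<open>- k' - 1\<close>:
    reversal exchanges its two sides, so the two prefactors have to be mutually inverse.\<close>
  have "?X i (- k) * ?X j (- (k' + 1)) - scal (br j i powi sg (opp e)) * ?X j (- (k' + 1)) * ?X i (- k) =
    - scal (?d powi sg (opp e)) *
      (?X j (- k') * ?X i (- (k + 1)) - scal (br i j powi sg (opp e)) * ?X i (- (k + 1)) * ?X j (- k'))"
    using x_x x_x_qaff [where 'n = 'n, of i j "opp e" "- k - 1" "- k' - 1"] by simp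
  moreover have "swap_K (br i j powi sg e) = br j i powi sg (opp e)" for i j
    by (simp add: swap_K_powi swap_K_br power_int_inverse power_int_minus)
  then have "tau_pre x = ?X j (- k') * ?X i (- (k + 1)) - scal (br i j powi sg (opp e)) * ?X i (- (k + 1)) * ?X j (- k')"
    and y: "tau_pre y = - scal (swap_K (?d powi sg e)) *
      (?X i (- k) * ?X j (- (k' + 1)) - scal (br j i powi sg (opp e)) * ?X j (- (k' + 1)) * ?X i (- k))"
    unfolding x_x(1,2)
    by (simp_all only: tau_pre_hom tau_letter.simps scal_central mult.assoc mult_minus_left mult_minus_right)
  moreover have "swap_K (?d powi sg e) * ?d powi sg (opp e) = 1"
  proof -
    have "swap_K ?d = ?d"
      by (simp add: swap_K_divide swap_K_brh field_simps)
    then show ?thesis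
      by (simp add: swap_K_powi power_int_minus)
  qed
  ultimately show ?thesis
    by simp
next
  case (xplus_xminus i j k k')
  show ?thesis
  proof (cases "i = j")
    case True
    let ?H = "\<lambda>k k'. gam' (- 2 * k) * gam (- (k + k')) * abs_qaff (om_mode i (k + k'))
          - gam (2 * k') * gam' (k + k') * abs_qaff (om_mode' i (k + k')) :: 'n qaff"
    \<comment> \<open>Reversing the order and exchanging x^+ with x^- keeps the sign of the
      commutator, but the modes also trade places.\<close>
    have "tau_pre x = gen (XG Plus i (- k')) * gen (XG Minus i (- k)) - gen (XG Minus i (- k)) * gen (XG Plus i (- k'))"
      by (simp add: xplus_xminus(1) tau_pre_hom True)
    also have "\<dots> = scal (1 / (r - s)) * ?H (- k') (- k)"
      using xplus_xminus by (subst xplus_xminus_qaff) simp_all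
    also have "?H (- k') (- k) = - (abs_qaff (om_mode' i (- (k + k'))) * (gam' (- (k + k')) * gam (- 2 * k))
        - abs_qaff (om_mode i (- (k + k'))) * (gam (k + k') * gam' (2 * k')))"
    proof -
      have "x * (gam' m * gam m') = gam m' * gam' m * x" "x * (gam m * gam' m') = gam' m' * gam m * x"
        for x :: "'n qaff" and m m'
        by (metis gam_central mult.assoc)+
      then show ?thesis
        by (simp add: add.commute)
    qed
    also have "scal (1 / (r - s)) * \<dots> = tau_pre y"
    proof -
      have "swap_K (1 / (r - s)) = - (1 / (r - s))"
        by (simp add: swap_K_divide swap_K_r_diff_s del: minus_diff_eq)
      then show ?thesis
        unfolding xplus_xminus(2) using True
        by (simp only: if_True simp_thms tau_pre_hom tau_pre_om_mode [OF xplus_xminus(4)] scal_uminus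
            scal_central mult_minus_left mult_minus_right)
    qed
    finally show ?thesis .
  next
    case False
    then show ?thesis
      using xplus_xminus xplus_xminus_qaff [where 'n = 'n, of j i "- k'" "- k"]
      by (simp add: tau_pre_hom)
  qed
next
  case (x_commute i j e m k)
  then show ?thesis
    by (simp only: tau_pre_hom tau_letter.simps) (metis x_commute_qaff)
next
  case (x_serre i j t e m1 m2 k)
  define p q where "p = r powi t" and "q = s powi t"
  have pq: "p \<noteq> 0" "q \<noteq> 0" "swap_K p = q" "swap_K q = p"
    by (simp_all add: p_def q_def swap_K_powi)
  \<comment> \<open>\<open>swap_K\<close> exchanges \<open>p\<close> and \<open>q\<close> and so
    fixes their sum and product; the reversed order of \<open>m1\<close> and \<open>m2\<close> is
    absorbed by the symmetrization.\<close>
  have *: "tau_pre (serre e i j p q m1 m2 k) =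
      scal (p * q) * serre_qaff (opp e) i j (inverse p) (inverse q) (- m2) (- m1) (- k)" for m1 m2
    unfolding serre_qaff_rescale [OF pq(1,2)] serre_def tau_pre_hom swap_K_add swap_K_mult pq
      tau_letter.simps
    by (simp add: mult.assoc scal_right mult.commute [of q p] add.commute [of q p])
  have "serre_qaff (opp e) i j (inverse p) (inverse q) (- m2) (- m1) (- k)
      + serre_qaff (opp e) i j (inverse p) (inverse q) (- m1) (- m2) (- k) = (0 :: 'n qaff)"
  proof -
    have "- t = (if i < j then sg (opp e) else - sg (opp e))"
      using x_serre(6) by simp
    from x_serre_qaff [OF x_serre(3-5) this, of "- m2" "- m1" "- k"] show ?thesis
      by (simp only: p_def q_def power_int_minus)
  qed
  then show ?thesis
    unfolding x_serre(1,2) tau_pre_hom p_def [symmetric] q_def [symmetric] *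
    by (simp flip: distrib_left)
qed

section \<open>Existence and uniqueness of \<open>\<tau>\<close>\<close>

lemma tau_pre_eq_if_cong_rel:
  assumes "cong_rel x y"
  shows "tau_pre x = tau_pre y"
proof -
  have "tau_pre z = 0" if "z \<in> rel_ideal" for z :: "'n free"
    using that
    by (induction rule: rel_ideal.induct) (simp_all add: tau_pre_hom tau_pre_eq_if_rel)
  then have "tau_pre (x - y) = 0"
    using assms by (simp add: cong_rel_def)
  then show ?thesis
    by (simp add: tau_pre_hom)
qed

lift_definition tau_qaff :: "'n qaff \<Rightarrow> 'n qaff" is tau_free
  using tau_pre_eq_if_cong_rel by (simp add: tau_pre_def flip: qaff.abs_eq_iff)

lemma tau_qaff_abs: "tau_qaff (abs_qaff x) = tau_pre x"
  by (simp add: tau_qaff.abs_eq tau_pre_def)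

lemma tau_qaff_hom:
  "tau_qaff (x + y) = tau_qaff x + tau_qaff y"
  "tau_qaff (x * y) = tau_qaff y * tau_qaff x"
  "tau_qaff 1 = 1"
  "tau_qaff (scal c) = scal (swap_K c)"
  "tau_qaff (gen g) = gen (tau_letter g)"
proof -
  obtain x' y' where "x = abs_qaff x'" "y = abs_qaff y'"
    using qaff_cases by metis
  then show "tau_qaff (x + y) = tau_qaff x + tau_qaff y" "tau_qaff (x * y) = tau_qaff y * tau_qaff x"
    by (simp_all only: tau_qaff_abs tau_pre_hom flip: abs_qaff_hom)
  show "tau_qaff 1 = 1" "tau_qaff (scal c) = scal (swap_K c)" "tau_qaff (gen g) = gen (tau_letter g)"
    by (simp_all only: tau_qaff_abs tau_pre_hom flip: abs_qaff_hom(6-8))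
qed

lemma tau_qaff_tau_qaff [simp]: "tau_qaff (tau_qaff x) = x"
  by (cases x rule: qaff_cases) (simp add: tau_qaff.abs_eq)

lemma is_tau_tau_qaff: "is_tau tau_qaff"
proof -
  have "bij tau_qaff"
    by (rule o_bij [of tau_qaff]) auto
  then show ?thesis
    by (simp add: is_tau_def tau_qaff_hom)
qed

lemma qaff_induct [case_names add mult scal gen]:
  fixes x :: "'n qaff"
  assumes add: "\<And>x y. P x \<Longrightarrow> P y \<Longrightarrow> P (x + y)"
    and mult: "\<And>x y. P x \<Longrightarrow> P y \<Longrightarrow> P (x * y)"
    and scal: "\<And>c. P (scal c)"
    and gen: "\<And>g. g \<in> letters CARD('n) \<Longrightarrow> P (gen g)"
  shows "P x"
proof -
  have word: "P (abs_qaff (Poly_Mapping.single (Abs_word w :: 'n word) 1))"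
    if "set w \<subseteq> letters CARD('n)" for w
    using that
  proof (induction w)
    case Nil
    have "(Abs_word [] :: 'n word) = 0"
      by (simp add: zero_word_def)
    then show ?case
      using scal [of 1] by (simp add: abs_qaff_hom)
  next
    case (Cons g w)
    then have "(Abs_word (g # w) :: 'n word) = Abs_word [g] + Abs_word w"
      by (simp add: plus_word_def Abs_word_inverse)
    then have "Poly_Mapping.single (Abs_word (g # w)) 1 =
        (genf g * Poly_Mapping.single (Abs_word w) 1 :: 'n free)"
      using Cons by (simp add: genf_def mult_single)
    then show ?case
      using Cons by (simp add: abs_qaff_hom mult gen)
  qed
  obtain y where "x = abs_qaff y"
    by (rule qaff_cases)
  moreover have "P (abs_qaff y)"
  proof (induction y rule: poly_mapping_add_induct)
    case (add y y')
    then show ?case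
      by (simp add: abs_qaff_hom assms(1))
  next
    case (single w c)
    have "Poly_Mapping.single w c = scalf c * Poly_Mapping.single w 1"
      by (simp add: scalf_def mult_single)
    moreover obtain v where "w = Abs_word v" "set v \<subseteq> letters CARD('n)"
      by (cases w) auto
    ultimately show ?case
      by (simp add: abs_qaff_hom mult scal word)
  qed
  ultimately show ?thesis
    by simp
qed

text \<open>Scalars are prescribed only at \<open>rh\<close> and \<open>sh\<close>;
  \<open>K_induct\<close> extends the agreement to all scalars, and \<open>qaff_induct\<close> to
  the whole algebra.\<close>

lemma is_tau_unique:
  fixes t u :: "'n qaff \<Rightarrow> 'n qaff"
  assumes t: "is_tau t" and u: "is_tau u"
  shows "t = u"
proof
  have hom_add: "v (x + y) = v x + v y" and hom_mult: "v (x * y) = v y * v x" and one: "v 1 = 1"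
    if "is_tau v" for v :: "'n qaff \<Rightarrow> 'n qaff" and x y
    using that by (simp_all add: is_tau_def)
  have eq_scal: "t (scal c) = u (scal c)" for c
  proof (induction c rule: K_induct)
    case one
    then show ?case using t u by (simp add: is_tau_def)
  next
    case rh
    then show ?case using t u by (simp add: is_tau_def)
  next
    case sh
    then show ?case using t u by (simp add: is_tau_def)
  next
    case (add a b)
    then show ?case using t u by (simp add: is_tau_def scal_add)
  next
    case (mult a b)
    then show ?case by (simp add: scal_mult hom_mult [OF t] hom_mult [OF u] del: scal_scal)
  next
    case (inverse a)
    have inv: "v (scal a) * v (scal (inverse a)) = 1" "v (scal (inverse a)) * v (scal a) = 1"
      if "is_tau v" for v :: "'n qaff \<Rightarrow> 'n qaff"
      using inverse one [OF that] by (simp_all flip: hom_mult [OF that])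
    \<comment> \<open>Both sides invert the common image of \<open>scal a\<close>, and inverses in a
      monoid are unique.\<close>
    have "t (scal (inverse a)) = t (scal (inverse a)) * (u (scal a) * u (scal (inverse a)))"
      by (simp add: inv u)
    also have "\<dots> = u (scal (inverse a))"
      unfolding inverse(1) [symmetric] by (simp add: inv t flip: mult.assoc)
    finally show ?case .
  next
    case (uminus a)
    have neg: "v (scal (- a)) = - v (scal a)" if "is_tau v" for v :: "'n qaff \<Rightarrow> 'n qaff"
      using hom_add [OF that, of "scal a" "scal (- a)"] hom_add [OF that, of 0 0]
      by (simp add: scal_uminus minus_unique)
    then show ?case
      using uminus by (simp only: neg [OF t] neg [OF u])
  qed
  fix x
  show "t x = u x"
  proof (induction x rule: qaff_induct)
    case (add x y)
    then show ?case using t u by (simp add: is_tau_def)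
  next
    case (mult x y)
    then show ?case by (simp add: hom_mult [OF t] hom_mult [OF u])
  next
    case (scal c)
    show ?case by (rule eq_scal)
  next
    case (gen g)
    have on_gen: "v (gen g) = gen (tau_letter g)" if "is_tau v" for v :: "'n qaff \<Rightarrow> 'n qaff"
      using gen that by (cases g) (auto simp: letters_def is_tau_def)
    show ?case
      by (simp only: on_gen [OF t] on_gen [OF u])
  qed
qed

text \<open>Existence and uniqueness together identify the definite description with the map
  obtained by descent.\<close>

lemma tau_eq_tau_qaff: "tau = tau_qaff"
  unfolding tau_def by (rule the_equality) (auto intro: is_tau_tau_qaff is_tau_unique)

lemmas tau_hom = tau_qaff_hom [folded tau_eq_tau_qaff]

lemma tau_tau [simp]: "tau (tau x) = x"
  by (simp add: tau_eq_tau_qaff)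

section \<open>Peeling off the nested bracket\<close>

lemma qcomm_mult_right:
  assumes "u * x = scal c * x * u" "u * y = scal d * y * (u :: 'n qaff)"
  shows "u * (x * y) = scal (c * d) * (x * y) * u"
proof -
  have "u * (x * y) = scal c * x * (u * y)"
    using assms(1) by (simp flip: mult.assoc)
  also have "\<dots> = scal (c * d) * (x * y) * u"
    unfolding assms(2) by (simp add: mult.assoc scal_right)
  finally show ?thesis .
qed

lemma qcomm_mult_left:
  assumes "u * x = scal c * x * u" "v * x = scal d * x * (v :: 'n qaff)"
  shows "(u * v) * x = scal (c * d) * x * (u * v)"
proof -
  have "(u * v) * x = u * (scal d * x * v)"
    using assms(2) by (simp add: mult.assoc)
  also have "\<dots> = scal d * (u * x) * v"
    by (simp add: mult.assoc scal_right)
  also have "\<dots> = scal (c * d) * x * (u * v)"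
    unfolding assms(1) by (simp add: mult.assoc mult.commute)
  finally show ?thesis .
qed

text \<open>Both monomials of the bracket acquire the same weight \<open>c * d\<close>, so the
  bracket itself has this weight for every \<open>q\<close>.\<close>

lemma qcomm_qbracket:
  assumes "u * x = scal c * x * u" "u * y = scal d * y * (u :: 'n qaff)"
  shows "u * qbracket q x y = scal (c * d) * qbracket q x y * u"
proof -
  have "u * (scal q * y * x) = scal (c * d) * (scal q * y * x) * u"
    using qcomm_mult_right [OF assms(2,1)]
    by (simp add: mult.assoc scal_right mult.commute mult.left_commute)
  then show ?thesis
    using qcomm_mult_right [OF assms]
    by (simp add: qbracket_def right_diff_distrib left_diff_distrib)
qed

lemma qcomm_of_conj:
  assumes "u * x * v = scal c * x" "v * u = (1 :: 'n qaff)"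
  shows "u * x = scal c * x * u"
  using assms by (metis mult.assoc mult_1_right)

lemma qcomm_omega_xm:
  assumes "i \<in> nodes CARD('n)" "j \<in> nodes CARD('n)"
  shows "gen (OmG Plus i) * xm j k = scal (inverse (br j i)) * xm j k * (gen (OmG Plus i) :: 'n qaff)"
    and "gen (OmG' Plus i) * xm j k = scal (br i j) * xm j k * (gen (OmG' Plus i) :: 'n qaff)"
  using omega_x_qaff [OF assms, of Minus k] omega_inverse_pairs [OF assms(1)]
  by (auto intro!: qcomm_of_conj simp: power_int_minus)

lemma qcomm_omega_inverse_xp:
  assumes "i \<in> nodes CARD('n)" "j \<in> nodes CARD('n)"
  shows "gen (OmG Minus i) * xp j k = scal (inverse (br j i)) * xp j k * (gen (OmG Minus i) :: 'n qaff)"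
  using inverse_conj [OF omega_inverse_pairs(1,2) [OF assms(1)] omega_x_qaff(1) [OF assms, of Plus k]]
    omega_inverse_pairs [OF assms(1)]
  by (auto intro!: qcomm_of_conj)

text \<open>\<open>xm_nest k\<close> is \<open>[x\<^sub>k\<^sup>-(0), \<dots>, [x\<^sub>2\<^sup>-(0), x\<^sub>1\<^sup>-(1)]\<^sub>s \<dots>]\<^sub>s\<close> and \<open>om_inv k\<close> is \<open>(\<omega>\<^sub>1 \<cdots> \<omega>\<^sub>k)\<^sup>-\<^sup>1\<close>.\<close>

definition xm_nest :: "nat \<Rightarrow> 'n qaff" where
  "xm_nest k = foldr (qbracket s) (map (\<lambda>i. xm i 0) (rev [2..<Suc k])) (xm 1 1)"

definition om_inv :: "nat \<Rightarrow> 'n qaff" where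
  "om_inv k = prod_list (map (\<lambda>i. gen (OmG Minus i)) [1..<Suc k])"

lemma xm_nest_1: "xm_nest (Suc 0) = xm 1 1"
  by (simp add: xm_nest_def)

lemma xm_nest_Suc: "k \<ge> 1 \<Longrightarrow> xm_nest (Suc k) = qbracket s (xm (Suc k) 0) (xm_nest k)"
  by (simp add: xm_nest_def)

lemma om_inv_0: "om_inv 0 = 1"
  by (simp add: om_inv_def)

lemma om_inv_Suc: "om_inv (Suc k) = om_inv k * gen (OmG Minus (Suc k))"
  by (simp add: om_inv_def)

lemma xp_commute_xm_nest:
  assumes "1 \<le> k" "k < i" "i < CARD('n)"
  shows "xp i 0 * xm_nest k = (xm_nest k * xp i 0 :: 'n qaff)"
  using assms(1,2)
proof (induction k rule: dec_induct)
  case base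
  then show ?case
    using xplus_xminus_qaff [where 'n = 'n, of i 1 0 1] assms by (simp add: xm_nest_1 nodes_def)
next
  case (step k)
  have "xp i 0 * xm (Suc k) 0 = scal 1 * xm (Suc k) 0 * (xp i 0 :: 'n qaff)"
    using xplus_xminus_qaff [where 'n = 'n, of i "Suc k" 0 0] assms step by (simp add: nodes_def)
  from qcomm_qbracket [OF this, of "xm_nest k" 1 s] show ?case
    using step by (simp add: xm_nest_Suc)
qed

lemma omega_commute_xm_nest:
  assumes "1 \<le> k" "Suc k < i" "i < CARD('n)"
  shows "gen (OmG Plus i) * xm_nest k = (xm_nest k * gen (OmG Plus i) :: 'n qaff)"
    and "gen (OmG' Plus i) * xm_nest k = (xm_nest k * gen (OmG' Plus i) :: 'n qaff)"
proof -
  have x: "gen (OmG Plus i) * xm j m = scal 1 * xm j m * (gen (OmG Plus i) :: 'n qaff)"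
    "gen (OmG' Plus i) * xm j m = scal 1 * xm j m * (gen (OmG' Plus i) :: 'n qaff)"
    if "1 \<le> j" "Suc j < i" for j m
    using qcomm_omega_xm [where 'n = 'n, of i j m] that assms by (simp_all add: br_values nodes_def)
  have "gen (OmG Plus i) * xm_nest k = scal 1 * xm_nest k * (gen (OmG Plus i) :: 'n qaff) \<and>
    gen (OmG' Plus i) * xm_nest k = scal 1 * xm_nest k * (gen (OmG' Plus i) :: 'n qaff)"
    using assms(1,2)
  proof (induction k rule: dec_induct)
    case base
    then show ?case
      using x [of 1 1] by (simp add: xm_nest_1)
  next
    case (step k)
    then have "gen (OmG Plus i) * xm_nest k = scal 1 * xm_nest k * (gen (OmG Plus i) :: 'n qaff)"
      "gen (OmG' Plus i) * xm_nest k = scal 1 * xm_nest k * (gen (OmG' Plus i) :: 'n qaff)"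
      by simp_all
    from qcomm_qbracket [OF x(1) [of "Suc k" 0] this(1), of s]
      qcomm_qbracket [OF x(2) [of "Suc k" 0] this(2), of s]
    show ?case
      using step by (simp add: xm_nest_Suc)
  qed
  then show "gen (OmG Plus i) * xm_nest k = (xm_nest k * gen (OmG Plus i) :: 'n qaff)"
    "gen (OmG' Plus i) * xm_nest k = (xm_nest k * gen (OmG' Plus i) :: 'n qaff)"
    by simp_all
qed

text \<open>Of the letters in the nest only the one at node \<open>k\<close> is adjacent to node
  \<open>Suc k\<close>. It contributes the weights r and s, the others contribute 1.\<close>

lemma qcomm_omega_Suc_xm_nest:
  assumes "1 \<le> k" "Suc k < CARD('n)"
  shows "gen (OmG Plus (Suc k)) * xm_nest k = scal r * xm_nest k * (gen (OmG Plus (Suc k)) :: 'n qaff)"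
    and "gen (OmG' Plus (Suc k)) * xm_nest k = scal s * xm_nest k * (gen (OmG' Plus (Suc k)) :: 'n qaff)"
proof -
  have x: "gen (OmG Plus (Suc k)) * xm k m = scal r * xm k m * (gen (OmG Plus (Suc k)) :: 'n qaff)"
    "gen (OmG' Plus (Suc k)) * xm k m = scal s * xm k m * (gen (OmG' Plus (Suc k)) :: 'n qaff)" for m
    using qcomm_omega_xm [where 'n = 'n, of "Suc k" k m] br_values(2,3) [of k] assms
    by (simp_all add: nodes_def)
  have "gen (OmG Plus (Suc k)) * xm_nest k = scal r * xm_nest k * (gen (OmG Plus (Suc k)) :: 'n qaff) \<and>
    gen (OmG' Plus (Suc k)) * xm_nest k = scal s * xm_nest k * (gen (OmG' Plus (Suc k)) :: 'n qaff)"
  proof (cases "k = 1")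
    case True
    then show ?thesis
      using x [of 1] by (simp add: xm_nest_1)
  next
    case False
    then obtain m where m: "k = Suc m" "1 \<le> m"
      using assms by (metis One_nat_def Suc_le_D le_eq_less_or_eq less_Suc_eq_le not_less_eq_eq)
    have "gen (OmG Plus (Suc k)) * xm_nest m = scal 1 * xm_nest m * (gen (OmG Plus (Suc k)) :: 'n qaff)"
      "gen (OmG' Plus (Suc k)) * xm_nest m = scal 1 * xm_nest m * (gen (OmG' Plus (Suc k)) :: 'n qaff)"
      using omega_commute_xm_nest [where 'n = 'n, of m "Suc k"] m assms by simp_all
    from qcomm_qbracket [OF x(1) [of 0] this(1), of s] qcomm_qbracket [OF x(2) [of 0] this(2), of s]
    show ?thesis
      using m by (simp add: xm_nest_Suc)
  qed
  then show "gen (OmG Plus (Suc k)) * xm_nest k = scal r * xm_nest k * (gen (OmG Plus (Suc k)) :: 'n qaff)"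
    "gen (OmG' Plus (Suc k)) * xm_nest k = scal s * xm_nest k * (gen (OmG' Plus (Suc k)) :: 'n qaff)"
    by simp_all
qed

lemma om_inv_commute_xp:
  assumes "Suc k < i" "i < CARD('n)"
  shows "om_inv k * xp i m = (xp i m * om_inv k :: 'n qaff)"
  using assms(1)
proof (induction k)
  case (Suc k)
  have "gen (OmG Minus (Suc k)) * xp i m = (xp i m * gen (OmG Minus (Suc k)) :: 'n qaff)"
    using qcomm_omega_inverse_xp [where 'n = 'n, of "Suc k" i m] Suc.prems assms
    by (simp add: br_values nodes_def)
  with Suc.IH [OF Suc_lessD [OF Suc.prems]] show ?case
    unfolding om_inv_Suc by (rule commute_mult)
qed (simp add: om_inv_0)

text \<open>The inverse of omega_k contributes 1/s and that of omega_{k+1} contributes s/r, while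
  the earlier factors commute with the letter.\<close>

lemma qcomm_om_inv_xp:
  assumes "1 \<le> k" "Suc k < CARD('n)"
  shows "om_inv (Suc k) * xp (Suc k) m = (scal (inverse r) * xp (Suc k) m * om_inv (Suc k) :: 'n qaff)"
proof -
  obtain l where k: "k = Suc l"
    using assms by (cases k) auto
  have "om_inv l * xp (Suc k) m = scal 1 * xp (Suc k) m * (om_inv l :: 'n qaff)"
    using om_inv_commute_xp [where 'n = 'n, of l "Suc k" m] assms k by simp
  moreover have "gen (OmG Minus k) * xp (Suc k) m =
      scal (inverse s) * xp (Suc k) m * (gen (OmG Minus k) :: 'n qaff)"
    using qcomm_omega_inverse_xp [where 'n = 'n, of k "Suc k" m] br_values(3) [of k] assms
    by (simp add: nodes_def)
  moreover have "gen (OmG Minus (Suc k)) * xp (Suc k) m =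
      scal (inverse (r * inverse s)) * xp (Suc k) m * (gen (OmG Minus (Suc k)) :: 'n qaff)"
    using qcomm_omega_inverse_xp [where 'n = 'n, of "Suc k" "Suc k" m] br_values(1) [of "Suc k"] assms
    by (simp add: nodes_def)
  ultimately have "om_inv l * gen (OmG Minus k) * gen (OmG Minus (Suc k)) * xp (Suc k) m =
      scal (1 * inverse s * inverse (r * inverse s)) * xp (Suc k) m *
        (om_inv l * gen (OmG Minus k) * gen (OmG Minus (Suc k)) :: 'n qaff)"
    by (intro qcomm_mult_left)
  moreover have "1 * inverse s * inverse (r * inverse s) = inverse r"
    by (simp add: field_simps)
  ultimately show ?thesis
    by (simp only: om_inv_Suc k)
qed

lemma omega_commute_om_inv:
  assumes "k < i" "i < CARD('n)"
  shows "gen (OmG Plus i) * om_inv k = (om_inv k * gen (OmG Plus i) :: 'n qaff)"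
  using assms(1)
proof (induction k)
  case (Suc k)
  have "gen (OmG Minus (Suc k)) * gen (OmG Plus i) = (gen (OmG Plus i) * gen (OmG Minus (Suc k)) :: 'n qaff)"
    using Suc.prems assms by (intro torus_commute_qaff) (auto simp: torus_def nodes_def)
  with Suc.IH [OF Suc_lessD [OF Suc.prems], symmetric] show ?case
    unfolding om_inv_Suc by (rule commute_mult [symmetric])
qed (simp add: om_inv_0)

section \<open>Low modes and a single bracketing step\<close>

lemma om_mode_low:
  "abs_qaff (om_mode i 0) = gen (OmG Plus i)" "abs_qaff (om_mode' i 0) = gen (OmG' Plus i)"
  "abs_qaff (om_mode i 1) = gen (OmG Plus i) * (scal (r - s) * gen (AG i 1))"
  "abs_qaff (om_mode' i 1) = 0"
  by (simp_all add: om_mode_def om_mode'_def exp_coeff_def abs_qaff_hom)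

lemma gam_0 [simp]: "gam 0 = 1" "gam' 0 = 1"
  by (simp_all add: gam_eq)

lemma xp_xm_bracket:
  assumes "i \<in> nodes CARD('n)"
  shows "xp i 0 * xm i 0 - xm i 0 * xp i 0 =
    scal (1 / (r - s)) * (gen (OmG Plus i) - gen (OmG' Plus i) :: 'n qaff)"
  using xplus_xminus_qaff [OF assms assms, of 0 0] by (simp add: om_mode_low)

text \<open>With Y the inner nest, the weights r and s give (omega - omega') Y - s Y (omega -
  omega') = (r - s) Y omega: the bracket parameter s is exactly the weight that cancels
  omega'.\<close>

lemma xp_xm_nest_bracket:
  assumes "1 \<le> k" "Suc k < CARD('n)"
  shows "xp (Suc k) 0 * xm_nest (Suc k) - xm_nest (Suc k) * xp (Suc k) 0 =
    (xm_nest k * gen (OmG Plus (Suc k)) :: 'n qaff)"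
proof -
  define x m y w w' :: "'n qaff" and c where "x = xp (Suc k) 0" and "m = xm (Suc k) 0"
    and "y = xm_nest k" and "w = gen (OmG Plus (Suc k))" and "w' = gen (OmG' Plus (Suc k))"
    and "c = 1 / (r - s)"
  have xy: "x * y = y * x"
    unfolding x_def y_def using assms by (intro xp_commute_xm_nest) auto
  have wy: "w * y = scal r * y * w" "w' * y = scal s * y * w'"
    unfolding w_def w'_def y_def by (intro qcomm_omega_Suc_xm_nest assms)+
  have h: "x * m - m * x = scal c * (w - w')"
    unfolding x_def m_def w_def w'_def c_def using assms by (intro xp_xm_bracket) (auto simp: nodes_def)
  \<comment> \<open>As \<open>x\<close> commutes with \<open>y\<close>, the commutator with
    \<open>x\<close> acts only on the factor \<open>m\<close>.\<close>
  have "x * qbracket s m y - qbracket s m y * x = (x * m - m * x) * y - scal s * y * (x * m - m * x)"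
  proof -
    have "x * (scal s * y * m) = scal s * (x * y) * m" "m * y * x = m * (y * x)"
      by (simp_all add: mult.assoc scal_right)
    then have "x * (scal s * y * m) = scal s * y * (x * m)" "m * y * x = m * x * y"
      by (simp_all only: xy mult.assoc)
    then show ?thesis
      by (simp add: qbracket_def right_diff_distrib left_diff_distrib mult.assoc)
  qed
  also have "\<dots> = scal (c * (r - s)) * (y * w)"
  proof -
    have "scal (c * (r - s)) = (scal (c * r) - scal (c * s) :: 'n qaff)"
      by (simp only: right_diff_distrib scal_diff)
    then show ?thesis
      unfolding h
      by (simp add: left_diff_distrib right_diff_distrib mult.assoc scal_right wy
          mult.commute [of s c])
  qed
  also have "c * (r - s) = 1"
    by (simp add: c_def)
  finally show ?thesis
    using assms by (simp add: x_def m_def y_def w_def xm_nest_Suc)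
qed

text \<open>The parameter r compensates the weight 1/r of \<open>om_inv\<close> on the raising
  letter, so an ordinary commutator with the nest remains. The omega_{k+1} that it produces cancels
  the last factor of \<open>om_inv (Suc k)\<close>.\<close>

lemma qbracket_E_nest:
  assumes "1 \<le> k" "Suc k < CARD('n)"
  shows "qbracket r (E (Suc k)) (xm_nest (Suc k) * gamma' Minus * om_inv (Suc k)) =
    (xm_nest k * gamma' Minus * om_inv k :: 'n qaff)"
proof -
  define x y g u w v :: "'n qaff" where "x = xp (Suc k) 0" and "y = xm_nest (Suc k)"
    and "g = gamma' Minus" and "u = om_inv k" and "w = gen (OmG Plus (Suc k))"
    and "v = gen (OmG Minus (Suc k))"
  have g: "g * z = z * g" for z
    unfolding g_def gamma'_def by (intro power_commuting_commutes gamma_central_qaff)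
  have ux: "(u * v) * x = scal (inverse r) * x * (u * v)"
    using qcomm_om_inv_xp [OF assms] by (simp add: u_def v_def x_def om_inv_Suc)
  have wu: "w * u = u * w"
    unfolding w_def u_def using assms by (intro omega_commute_om_inv) auto
  have wv: "w * v = 1"
    unfolding w_def v_def using assms by (intro omega_inverse_pairs) (auto simp: nodes_def)
  have "scal r * (y * g * (u * v)) * x = scal r * (y * g * ((u * v) * x))"
    by (simp add: mult.assoc)
  also have "\<dots> = y * (g * x) * (u * v)"
    unfolding ux by (simp add: mult.assoc scal_right)
  also have "\<dots> = y * x * g * (u * v)"
    by (simp add: g mult.assoc)
  finally have "qbracket r x (y * g * (u * v)) = (x * y - y * x) * g * (u * v)"
    by (simp add: qbracket_def left_diff_distrib mult.assoc)
  also have "x * y - y * x = xm_nest k * w"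
    unfolding x_def y_def w_def by (rule xp_xm_nest_bracket [OF assms])
  also have "xm_nest k * w * g * (u * v) = xm_nest k * g * ((w * u) * v)"
    by (simp add: mult.assoc g [of w, symmetric])
  also have "\<dots> = xm_nest k * g * u"
    unfolding wu by (simp add: mult.assoc wv)
  finally show ?thesis
    by (simp add: E_def x_def y_def g_def u_def v_def om_inv_Suc mult.assoc)
qed

text \<open>\<open>foldr\<close> applies the last entry first, so each induction step peels off the
  innermost bracket and shortens the nest by one.\<close>

lemma foldr_E_nest:
  assumes "1 \<le> k" "k < CARD('n)"
  shows "foldr (qbracket r) (map E [2..<Suc k]) (xm_nest k * gamma' Minus * om_inv k) =
    (xm 1 1 * gamma' Minus * gen (OmG Minus 1) :: 'n qaff)"
  using assms
proof (induction k rule: dec_induct)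
  case base
  then show ?case
    by (simp add: xm_nest_1 om_inv_0 om_inv_Suc)
next
  case (step k)
  then have "[2..<Suc (Suc k)] = [2..<Suc k] @ [Suc k]"
    by simp
  then show ?case
    using step qbracket_E_nest [where 'n = 'n, of k] by simp
qed

text \<open>\<open>rnested\<close> consumes its parameters from the end of the list; when they are
  all equal it is a plain right fold.\<close>

lemma rnested_replicate:
  "rnested (replicate (length as) q) (as @ [b]) = foldr (qbracket q) as b"
proof (induction as)
  case (Cons a as)
  obtain c cs where c: "as @ [b] = c # cs"
    by (cases "as @ [b]") auto
  have "rnested (replicate (length (a # as)) q) ((a # as) @ [b]) =
      qbracket (last (replicate (Suc (length as)) q)) a (rnested (butlast (replicate (Suc (length as)) q)) (as @ [b]))"
    by (simp only: append_Cons c rnested.simps list.size) simp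
  also have "butlast (replicate (Suc (length as)) q) = replicate (length as) q"
    by (simp flip: replicate_append_same)
  also have "last (replicate (Suc (length as)) q) = q"
    by (simp add: last_replicate)
  finally show ?case
    by (simp add: Cons)
qed simp

section \<open>The closed formula for x_1^-(1)\<close>

lemma xm_theta_eq:
  assumes "CARD('n) > 2"
  shows "(xm_theta :: 'n qaff) = xm_nest (CARD('n) - 1)"
  using rnested_replicate [of "map (\<lambda>i. xm i 0) (rev [2..<CARD('n)])" s "xm 1 1 :: 'n qaff"] assms
  by (simp add: xm_theta_def xm_nest_def Suc_diff_Suc)

lemma E_0_eq:
  assumes "CARD('n) > 2"
  shows "(E 0 :: 'n qaff) = xm_nest (CARD('n) - 1) * gamma' Minus * om_inv (CARD('n) - 1)"
  using assms by (simp add: E_def xm_theta_eq om_theta_def om_inv_def)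

lemma xm_1_1_eq:
  fixes B :: "'n qaff"
  assumes "CARD('n) > 2"
    and B: "B = rnested (replicate (CARD('n) - 2) r) (map E ([2..<CARD('n)] @ [0])) * gamma' Plus * om Plus 1"
  shows "xm 1 1 = B"
proof -
  have "rnested (replicate (CARD('n) - 2) r) (map E ([2..<CARD('n)] @ [0])) =
      foldr (qbracket r) (map E [2..<CARD('n)]) (E 0 :: 'n qaff)"
    using rnested_replicate [of "map E [2..<CARD('n)]" r "E 0 :: 'n qaff"] by simp
  also have "\<dots> = xm 1 1 * gamma' Minus * gen (OmG Minus 1)"
    using foldr_E_nest [where 'n = 'n, of "CARD('n) - 1"] assms(1) by (simp add: E_0_eq)
  finally have "B = xm 1 1 * gamma' Minus * (gen (OmG Minus 1) * gamma' Plus) * gen (OmG Plus 1)"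
    by (simp add: B om_def mult.assoc)
  moreover have "gen (OmG Minus 1) * gamma' Plus = (gamma' Plus * gen (OmG Minus 1) :: 'n qaff)"
    unfolding gamma'_def by (rule power_commuting_commutes [OF gamma_central_qaff(2), symmetric])
  moreover have "gamma' Minus * gamma' Plus = (1 :: 'n qaff)"
  proof -
    have "gen (GamG' Minus) * gen (GamG' Plus) = (1 :: 'n qaff)"
      using gamma_inverse_qaff(2) [of Minus] by simp
    then show ?thesis
      unfolding gamma'_def power2_eq_square by (metis mult.assoc mult_1_left)
  qed
  moreover have "gen (OmG Minus 1) * gen (OmG Plus 1) = (1 :: 'n qaff)"
    using assms(1) by (intro omega_inverse_pairs) (auto simp: nodes_def)
  ultimately show ?thesis
    by (metis mult.assoc mult_1_right)
qed

section \<open>The subalgebra \<open>U'\<close>\<close>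

lemma U'_add: "x \<in> U' \<Longrightarrow> y \<in> U' \<Longrightarrow> x + y \<in> U'"
  and U'_mult: "x \<in> U' \<Longrightarrow> y \<in> U' \<Longrightarrow> x * y \<in> U'"
  and U'_scal: "scal c \<in> U'"
  by (auto simp: U'_def intro: subalgebra_generated.intros)

lemma U'_diff: "x \<in> U' \<Longrightarrow> y \<in> U' \<Longrightarrow> x - y \<in> U'"
  using U'_add [of x "scal (- 1) * y"] U'_mult [OF U'_scal, of y "- 1"] by (simp add: scal_uminus)

lemma U'_1: "1 \<in> U'"
  using U'_scal [of 1] by simp

lemma U'_power: "x \<in> U' \<Longrightarrow> x ^ k \<in> U'"
  by (induction k) (simp_all add: U'_mult U'_1)

lemma U'_generators:
  "i < CARD('n) \<Longrightarrow> (E i :: 'n qaff) \<in> U'"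
  "i < CARD('n) \<Longrightarrow> (F i :: 'n qaff) \<in> U'"
  "i < CARD('n) \<Longrightarrow> (om e i :: 'n qaff) \<in> U'"
  "i < CARD('n) \<Longrightarrow> (om' e i :: 'n qaff) \<in> U'"
  "gen (GamG e) \<in> U'" "gen (GamG' e) \<in> U'" "gen (DG e) \<in> U'" "gen (DG' e) \<in> U'"
  unfolding U'_def by (rule subalgebra_generated.base, blast)+

lemma U'_gam: "gam m \<in> U'" "gam' m \<in> U'"
  by (simp_all add: gam_eq U'_power U'_generators)

lemma U'_qbracket: "x \<in> U' \<Longrightarrow> y \<in> U' \<Longrightarrow> qbracket q x y \<in> U'"
  by (simp add: qbracket_def U'_diff U'_mult U'_scal)

lemma U'_foldr_qbracket: "set xs \<subseteq> U' \<Longrightarrow> y \<in> U' \<Longrightarrow> foldr (qbracket q) xs y \<in> U'"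
  by (induction xs) (auto intro: U'_qbracket)

section \<open>From one node to the next\<close>

lemma gam_inverse: "gam 1 * gam (- 1) = 1" "gam' 1 * gam' (- 1) = 1"
  using gamma_inverse_qaff [of Plus] by (simp_all add: gam_eq)

text \<open>In the commutator at modes 0 and 1 the term omega'_i(1) vanishes and omega_i(1) is
  linear in a_i(1), which can therefore be solved for.\<close>

lemma a_1_eq:
  assumes i: "i \<in> nodes CARD('n)"
  shows "gen (AG i 1) = (gam 1 * gen (OmG Minus i) * (xp i 0 * xm i 1 - xm i 1 * xp i 0) :: 'n qaff)"
proof -
  have "scal (1 / (r - s)) * (gam (- 1) * (gen (OmG Plus i) * (scal (r - s) * gen (AG i 1)))) =
      scal (1 / (r - s) * (r - s)) * (gam (- 1) * (gen (OmG Plus i) * gen (AG i 1)) :: 'n qaff)"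
    by (simp add: scal_right del: times_divide_eq_left)
  then have "xp i 0 * xm i 1 - xm i 1 * xp i 0 = (gam (- 1) * (gen (OmG Plus i) * gen (AG i 1)) :: 'n qaff)"
    using xplus_xminus_qaff [OF i i, of 0 1] by (simp add: om_mode_low)
  moreover have "gam 1 * gen (OmG Minus i) * (gam (- 1) * (gen (OmG Plus i) * gen (AG i 1))) =
      (gam 1 * gam (- 1)) * (gen (OmG Minus i) * gen (OmG Plus i)) * (gen (AG i 1) :: 'n qaff)"
    by (metis gam_central(1) mult.assoc)
  ultimately show ?thesis
    by (simp add: gam_inverse omega_inverse_pairs [OF i])
qed

text \<open>As a_{i,i+1} = -1, the scalar in the commutator of a_i(1) with x_{i+1}^-(0) is exactly
  1; the factor \<open>gam' 1\<close> removes the remaining gamma'^{-1/2}.\<close>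

lemma xm_Suc_1_eq:
  assumes "i \<in> nodes CARD('n)" "Suc i \<in> nodes CARD('n)"
  shows "xm (Suc i) 1 = (gam' 1 * (gen (AG i 1) * xm (Suc i) 0 - xm (Suc i) 0 * gen (AG i 1)) :: 'n qaff)"
proof -
  have "cartan i (Suc i) = - 1"
    by (simp add: cartan_def eps_alpha_def)
  then have "acoeff i (Suc i) 1 = s - r"
    by (simp add: acoeff_def brh_diag r_def s_def power_int_minus field_simps power2_eq_square)
  then have "of_int (sg Minus) * acoeff i (Suc i) 1 / (of_int 1 * (r - s)) = 1"
    by (simp add: field_simps)
  then show ?thesis
    using a_x_qaff [OF assms, of 1 Minus 0]
    by (simp only:) (simp add: gam_inverse flip: mult.assoc)
qed

lemma xm_1_in_U':
  assumes "xm 1 1 \<in> (U' :: 'n qaff set)" "i \<in> nodes CARD('n)"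
  shows "xm i 1 \<in> (U' :: 'n qaff set)"
proof -
  have "1 \<le> i" "i < CARD('n)"
    using assms(2) by (auto simp: nodes_def)
  then show ?thesis
  proof (induction i rule: dec_induct)
    case base
    show ?case by (rule assms(1))
  next
    case (step i)
    then have i: "i \<in> nodes CARD('n)" "Suc i \<in> nodes CARD('n)"
      by (auto simp: nodes_def)
    have "xp i 0 \<in> (U' :: 'n qaff set)" "xm (Suc i) 0 \<in> (U' :: 'n qaff set)"
      "gen (OmG Minus i) \<in> (U' :: 'n qaff set)"
      using U'_generators(1) [where 'n = 'n, of i] U'_generators(2) [where 'n = 'n, of "Suc i"]
        U'_generators(3) [where 'n = 'n, of i Minus] step
      by (simp_all add: E_def F_def om_def)
    then have "gen (AG i 1) \<in> (U' :: 'n qaff set)"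
      unfolding a_1_eq [OF i(1)] using step by (intro U'_mult U'_diff U'_gam) auto
    then show ?case
      unfolding xm_Suc_1_eq [OF i] using \<open>xm (Suc i) 0 \<in> U'\<close> by (intro U'_mult U'_diff U'_gam)
  qed
qed

section \<open>The action of tau on brackets and on the subalgebra\<close>

lemma tau_uminus: "tau (- x) = - tau x"
proof -
  have "tau (- x) = tau (scal (- 1) * x)"
    by (simp add: scal_uminus)
  also have "\<dots> = - tau x"
    unfolding tau_hom by (simp add: swap_K_uminus scal_uminus)
  finally show ?thesis .
qed

lemma tau_diff: "tau (x - y) = tau x - tau y"
  using tau_hom(1) [of x "- y"] by (simp add: tau_uminus)

lemma tau_qbracket: "tau (qbracket q x y) = qbracket (swap_K q) (tau y) (tau x)"
  by (simp add: qbracket_def tau_diff tau_hom mult.assoc scal_right)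

text \<open>An antiautomorphism exchanges the two arguments of each bracket, so right nesting
  becomes left nesting and the list is reversed.\<close>

lemma tau_foldr_qbracket:
  "tau (foldr (qbracket q) xs y) = foldl (qbracket (swap_K q)) (tau y) (rev (map tau xs))"
  by (induction xs) (simp_all add: tau_qbracket)

lemma tau_prod_list: "tau (prod_list xs) = prod_list (rev (map tau xs))"
  by (induction xs) (simp_all add: tau_hom)

text \<open>Since tau reverses the product in \<open>om_theta\<close>, its commuting factors have to
  be brought back into their original order.\<close>

lemma prod_list_rev_commute:
  fixes xs :: "'a::monoid_mult list"
  assumes "\<And>x y. x \<in> set xs \<Longrightarrow> y \<in> set xs \<Longrightarrow> x * y = y * x"
  shows "prod_list (rev xs) = prod_list xs"
  using assms
proof (induction xs)
  case (Cons x xs)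
  have "prod_list ys * x = x * prod_list ys" if "set ys \<subseteq> set xs" for ys
    using that
  proof (induction ys)
    case (Cons y ys)
    then show ?case
      using Cons.prems \<open>\<And>y z. y \<in> set (x # xs) \<Longrightarrow> z \<in> set (x # xs) \<Longrightarrow> y * z = z * y\<close> [of y x]
      by (auto intro: commute_mult)
  qed simp
  with Cons show ?case by simp
qed simp

lemma tau_om_theta: "tau (om_theta e :: 'n qaff) = om_theta' e"
proof -
  have "tau (om_theta e :: 'n qaff) = prod_list (rev (map (\<lambda>i. gen (OmG' e i)) [1..<CARD('n)]))"
    by (simp add: om_theta_def tau_prod_list tau_hom o_def)
  also have "\<dots> = om_theta' e"
    unfolding om_theta'_def
    by (rule prod_list_rev_commute) (auto intro!: torus_commute_qaff simp: torus_def nodes_def)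
  finally show ?thesis .
qed

lemma tau_gamma: "tau (gamma' e) = gamma e" "tau (gamma e) = gamma' e"
  by (simp_all add: gamma_def gamma'_def power2_eq_square tau_hom)

lemma gamma_central: "gamma e * x = x * gamma e"
  unfolding gamma_def by (intro power_commuting_commutes gamma_central_qaff)

lemma tau_om: "tau (om e i :: 'n qaff) = om' e i"
  by (simp add: om_def om'_def tau_hom tau_om_theta tau_gamma gamma_central)

lemma tau_xm_theta:
  assumes "CARD('n) > 2"
  shows "tau (xm_theta :: 'n qaff) = xp_theta"
  unfolding xm_theta_eq [OF assms] using assms
  by (simp add: xm_nest_def xp_theta_def tau_foldr_qbracket tau_hom rev_map o_def Suc_diff_Suc)

text \<open>For \<open>i = 0\<close> reversal puts gamma^{-1} behind the torus factor; its
  centrality restores the order used in \<open>F\<close>.\<close>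

lemma tau_E:
  assumes "CARD('n) > 2"
  shows "tau (E i :: 'n qaff) = F i"
  by (simp add: E_def F_def tau_hom tau_xm_theta [OF assms] tau_om_theta tau_gamma mult.assoc)
    (metis gamma_central mult.assoc)

text \<open>The generators are permuted: E_i with F_i, and omega_i, gamma, D with their primed
  partners. Scalars go to scalars, so semilinearity does no harm.\<close>

lemma tau_in_U':
  assumes "CARD('n) > 2" "(x :: 'n qaff) \<in> U'"
  shows "tau x \<in> U'"
  using assms(2) unfolding U'_def
proof (induction rule: subalgebra_generated.induct)
  case (base x)
  have "tau (F i :: 'n qaff) = E i" "tau (om' e i :: 'n qaff) = om e i" for e i
    by (metis tau_E [OF assms(1)] tau_tau, metis tau_om tau_tau)
  with base show ?case
    unfolding U'_def [symmetric]
    by (auto simp: tau_E [OF assms(1)] tau_om tau_hom intro: U'_generators)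
next
  case (scal c)
  then show ?case
    by (simp add: tau_hom subalgebra_generated.scal)
next
  case (add x y)
  then show ?case
    by (simp add: tau_hom subalgebra_generated.add)
next
  case (mult x y)
  then show ?case
    by (simp add: tau_hom subalgebra_generated.mult)
qed

theorem lemma4p7:
  fixes B :: "'n qaff"
  assumes "CARD('n) > 2"
    and B_eq: "B = rnested (replicate (CARD('n) - 2) r) (map E ([2..<CARD('n)] @ [0]))
      * gamma' Plus * om Plus 1"
  shows "(xm 1 1 = B \<and> B \<in> U' \<and> (\<forall>i \<in> nodes CARD('n). (xm i 1 :: 'n qaff) \<in> U')) \<and>
    (xp 1 (- 1) = tau B \<and>
     tau B = gamma Plus * om' Plus 1 * lnested s (map F (0 # rev [2..<CARD('n)])) \<and>
     tau B \<in> U' \<and> (\<forall>i \<in> nodes CARD('n). (xp i (- 1) :: 'n qaff) \<in> U'))"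
proof -
  have B: "B = foldr (qbracket r) (map E [2..<CARD('n)]) (E 0) * gamma' Plus * om Plus 1"
    using rnested_replicate [of "map E [2..<CARD('n)]" r "E 0 :: 'n qaff"] by (simp add: B_eq)
  have xm_eq: "xm 1 1 = B"
    by (rule xm_1_1_eq [OF assms])
  have "gamma' Plus \<in> (U' :: 'n qaff set)"
    by (simp add: gamma'_def U'_power U'_generators)
  then have B_in: "B \<in> U'"
    unfolding B using assms(1)
    by (intro U'_mult U'_foldr_qbracket U'_generators) (auto intro: U'_generators)
  have xm_in: "xm i 1 \<in> (U' :: 'n qaff set)" if "i \<in> nodes CARD('n)" for i
    using xm_1_in_U' B_in xm_eq that by blast
  \<comment> \<open>This transports every claim about x_i^-(1) to the corresponding claim about
    x_i^+(-1).\<close>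
  have xp: "xp i (- 1) = tau (xm i 1)" for i
    by (simp add: tau_hom)
  have "tau B = om' Plus 1 * (gamma Plus * foldl (qbracket s) (F 0) (rev (map F [2..<CARD('n)])))"
    by (simp add: B tau_hom tau_om tau_gamma tau_foldr_qbracket tau_E [OF assms(1)] o_def)
  also have "\<dots> = gamma Plus * om' Plus 1 * lnested s (map F (0 # rev [2..<CARD('n)]))"
    by (simp add: rev_map) (metis gamma_central mult.assoc)
  finally have "tau B = gamma Plus * om' Plus 1 * lnested s (map F (0 # rev [2..<CARD('n)]))" .
  then show ?thesis
    using xm_eq B_in xm_in xp tau_in_U' [OF assms(1)] by metis
qed

end
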